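(* Let $G$ and $H$ be single-conclusion sequent calculi such that $H$ extends $\mathbf{FL_e}$. (i) Suppose $H$ is an axiomatic extension of $G$ by semi-analytic rules (possibly also the modal rules $4$ or $4D$, in which case the left weakening rule for boxed formulas, $\Gamma\Rightarrow\Delta/\Gamma,\Box\phi\Rightarrow\Delta$, is admissible in $H$). Then if $G$ has $H$-interpolation (resp. $H$-feasible interpolation), so does $H$. (ii) Suppose $H$ is an axiomatic extension of $G$ by semi-analytic rules and context-sharing semi-analytic rules, and the left weakening rule $\Gamma\Rightarrow\Delta/\Gamma,\phi\Rightarrow\Delta$, the right weakening rule $\Gamma\Rightarrow\,/\,\Gamma\Rightarrow\phi$ and the context-sharing left implication rule $\Gamma\Rightarrow\phi\ \ \Gamma,\psi\Rightarrow\Delta/\Gamma,\phi\to\psi\Rightarrow\Delta$ are admissible in $H$. Then if $G$ has $H$-interpolation (resp. $H$-feasible interpolation), so does $H$.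
   Context: Formulas in a fixed propositional language containing $\wedge,\vee,\to,*,0,1,\top,\bot$ and possibly $\Box$; $V(\cdot)$: atoms (for meta-formulas also formula variables). Single-conclusion sequents $\Gamma\Rightarrow\Delta$ ($|\Delta|\le1$, finite multisets). Rules: schemes over meta-formulas and meta-multiset variables. $H$ extends $\mathbf{FL_e}$: every $\mathbf{FL_e}$-provable sequent is $H$-provable, where $\mathbf{FL_e}$ has axioms $\phi\Rightarrow\phi$, $\Rightarrow1$, $0\Rightarrow$, $\Gamma\Rightarrow\top$, $\Gamma,\bot\Rightarrow\Delta$ and the standard single-conclusion rules for $1,0,\wedge,\vee,*$ (multiplicative $R*$) and $\to$ (multiplicative $L\to$: $\Gamma\Rightarrow\phi\ \ \Sigma,\psi\Rightarrow\Lambda/\Gamma,\Sigma,\phi\to\psi\Rightarrow\Lambda$). $H$ is an axiomatic extension of $G$ by rules $R$ if $H$ consists of all $G$-provable sequents as axioms plus the rules $R$. A rule is admissible if its conclusion is provable whenever its premises are. Semi-analytic rules: left: premises $\Pi_j,\bar\psi_{js}\Rightarrow\bar\theta_{js}$ and $\Gamma_i,\bar\phi_{ir}\Rightarrow\Delta_i$, conclusion $\Pi_1,\dots,\Pi_m,\Gamma_1,\dots,\Gamma_n,\phi\Rightarrow\Delta_1,\dots,\Delta_n$, with $\Pi_j,\Gamma_i,\Delta_i$ meta-multiset variables and all variables of $\bar\phi_{ir},\bar\psi_{js},\bar\theta_{js}$ in $V(\phi)$; right: premises $\Gamma_i,\bar\phi_{ir}\Rightarrow\bar\psi_{ir}$,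 conclusion $\Gamma_1,\dots,\Gamma_n\Rightarrow\phi$, variables in $V(\phi)$; modal: $K$: $\Gamma\Rightarrow\phi/\Box\Gamma\Rightarrow\Box\phi$, $D$: $\Gamma\Rightarrow/\Box\Gamma\Rightarrow$ (only with $K$), $RS4$: $\Box\Gamma\Rightarrow\phi/\Box\Gamma\Rightarrow\Box\phi$ (only with $LS4$: $\Gamma,\phi\Rightarrow\Delta/\Gamma,\Box\phi\Rightarrow\Delta$), $\Gamma$ a meta-multiset variable, $\Box\emptyset=\emptyset$. Rule $4$: $\Box\Gamma,\Gamma\Rightarrow\phi/\Box\Gamma\Rightarrow\Box\phi$; rule $4D$: $\Box\Gamma,\Gamma\Rightarrow/\Box\Gamma\Rightarrow$ (only with $4$). Context-sharing semi-analytic: premises $\Gamma_i,\bar\psi_{is}\Rightarrow\bar\theta_{is}$ and $\Gamma_i,\bar\phi_{ir}\Rightarrow\Delta_i$, conclusion $\Gamma_1,\dots,\Gamma_n,\phi\Rightarrow\Delta_1,\dots,\Delta_n$, variables in $V(\phi)$. $G$ has $H$-interpolation if whenever $\Sigma,\Lambda\Rightarrow\Delta$ has a tree-like $G$-proof $\pi$ there is $C$ with $H\vdash\Sigma\Rightarrow C$, $H\vdash\Lambda,C\Rightarrow\Delta$, $V(C)\subseteq V(\Sigma)\cap V(\Lambda\cup\Delta)$; $H$-feasible interpolation additionally requires $|C|\le|\pi|^{O(1)}$ ($|\cdot|$ = encoding length).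
   Formalization: "H extends FL_e" is taken to mean that all axioms and rules of FL_e are admissible in H (with only FL_e-theorems provable in H, the claim fails), and the length of an H-proof counts the G-proofs of the G-provable sequents used as axioms. *)

theory Defs
  imports Main "HOL-Library.Multiset" "HOL-Library.Discrete_Functions"
begin

section \<open>Formulas\<close>

text \<open>
  The language is fixed by a set \<open>L\<close> of connectives beyond the basic ones
  \<open>\<and>, \<or>, \<rightarrow>, *, 0, 1, \<top>, \<bottom>\<close>. Thus \<open>BoxC \<in> L\<close> expresses that the language contains \<open>\<box>\<close>;
  \<open>ExtC c n\<close> is a further \<open>n\<close>-ary connective.
\<close>

datatype 'c conn = BoxC | ExtC 'c nat

fun arity :: "'c conn \<Rightarrow> nat" where
  "arity BoxC = 1"
| "arity (ExtC c n) = n"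

text \<open>The set function \<open>V\<close> of the datatype yields the set of leaves occurring in a formula.\<close>

datatype (V: 'a, dead 'c) fm =
    Var 'a
  | One | Zero | Top | Bot
  | And "('a, 'c) fm" "('a, 'c) fm"
  | Or "('a, 'c) fm" "('a, 'c) fm"
  | Fus "('a, 'c) fm" "('a, 'c) fm"
  | Imp "('a, 'c) fm" "('a, 'c) fm"
  | Op "'c conn" "('a, 'c) fm list"

abbreviation Box :: "('a, 'c) fm \<Rightarrow> ('a, 'c) fm" where
  "Box \<phi> \<equiv> Op BoxC [\<phi>]"

fun in_lang :: "'c conn set \<Rightarrow> ('a, 'c) fm \<Rightarrow> bool" where
  "in_lang L (Var a) = True"
| "in_lang L One = True"
| "in_lang L Zero = True"
| "in_lang L Top = True"
| "in_lang L Bot = True"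
| "in_lang L (And \<phi> \<psi>) = (in_lang L \<phi> \<and> in_lang L \<psi>)"
| "in_lang L (Or \<phi> \<psi>) = (in_lang L \<phi> \<and> in_lang L \<psi>)"
| "in_lang L (Fus \<phi> \<psi>) = (in_lang L \<phi> \<and> in_lang L \<psi>)"
| "in_lang L (Imp \<phi> \<psi>) = (in_lang L \<phi> \<and> in_lang L \<psi>)"
| "in_lang L (Op k \<phi>s) = (k \<in> L \<and> length \<phi>s = arity k \<and> (\<forall>\<phi>\<in>set \<phi>s. in_lang L \<phi>))"

text \<open>The leaves of a formula are atoms, those of a meta-formula are atoms or formula variables.\<close>

type_synonym 'c form = "(nat, 'c) fm"

datatype mleaf = MAtom nat | MForm nat

type_synonym 'c mform = "(mleaf, 'c) fm"

fun inst_form :: "(nat \<Rightarrow> 'c form) \<Rightarrow> 'c mform \<Rightarrow> 'c form" where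
  "inst_form \<sigma> (Var (MAtom p)) = Var p"
| "inst_form \<sigma> (Var (MForm n)) = \<sigma> n"
| "inst_form \<sigma> One = One"
| "inst_form \<sigma> Zero = Zero"
| "inst_form \<sigma> Top = Top"
| "inst_form \<sigma> Bot = Bot"
| "inst_form \<sigma> (And \<phi> \<psi>) = And (inst_form \<sigma> \<phi>) (inst_form \<sigma> \<psi>)"
| "inst_form \<sigma> (Or \<phi> \<psi>) = Or (inst_form \<sigma> \<phi>) (inst_form \<sigma> \<psi>)"
| "inst_form \<sigma> (Fus \<phi> \<psi>) = Fus (inst_form \<sigma> \<phi>) (inst_form \<sigma> \<psi>)"
| "inst_form \<sigma> (Imp \<phi> \<psi>) = Imp (inst_form \<sigma> \<phi>) (inst_form \<sigma> \<psi>)"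
| "inst_form \<sigma> (Op k \<phi>s) = Op k (map (inst_form \<sigma>) \<phi>s)"

definition Vs :: "('a, 'c) fm multiset \<Rightarrow> 'a set" where
  "Vs M = (\<Union>\<phi>\<in>set_mset M. V \<phi>)"


section \<open>Sequents and rules\<close>

datatype 'x seq = Seq (ante: "'x multiset") (succ: "'x multiset")  (infix "\<Rightarrow>\<^sub>s" 45)

type_synonym 'c sequent = "'c form seq"

text \<open>
  A rule is a scheme over meta-formulas, meta-multiset variables \<open>\<Gamma>\<close> (\<open>Ctx\<close>) and
  boxed meta-multiset variables \<open>\<box>\<Gamma>\<close> (\<open>BoxCtx\<close>).
\<close>

datatype 'c item = MF "'c mform" | Ctx nat | BoxCtx nat

datatype 'c rule = Rule (prems: "'c item seq multiset") (concl: "'c item seq")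

fun inst_item :: "(nat \<Rightarrow> 'c form) \<Rightarrow> (nat \<Rightarrow> 'c form multiset) \<Rightarrow> 'c item \<Rightarrow> 'c form multiset"
  where
  "inst_item \<sigma> \<mu> (MF \<phi>) = {#inst_form \<sigma> \<phi>#}"
| "inst_item \<sigma> \<mu> (Ctx n) = \<mu> n"
| "inst_item \<sigma> \<mu> (BoxCtx n) = image_mset Box (\<mu> n)"

definition inst_seq ::
  "(nat \<Rightarrow> 'c form) \<Rightarrow> (nat \<Rightarrow> 'c form multiset) \<Rightarrow> 'c item seq \<Rightarrow> 'c sequent" where
  "inst_seq \<sigma> \<mu> S =
     (\<Sum>\<^sub># (image_mset (inst_item \<sigma> \<mu>) (ante S)) \<Rightarrow>\<^sub>s \<Sum>\<^sub># (image_mset (inst_item \<sigma> \<mu>) (succ S)))"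

definition single_conclusion :: "'x seq \<Rightarrow> bool" where
  "single_conclusion S \<longleftrightarrow> size (succ S) \<le> 1"

text \<open>
  All calculi are single-conclusion: only those instances of a scheme count in which every premise
  and the conclusion have at most one formula on the right.
\<close>

definition rule_instance ::
  "'c conn set \<Rightarrow> 'c rule \<Rightarrow> 'c sequent multiset \<Rightarrow> 'c sequent \<Rightarrow> bool" where
  "rule_instance L r Ps S \<longleftrightarrow>
     (\<exists>\<sigma> \<mu>. (\<forall>n. in_lang L (\<sigma> n)) \<and> (\<forall>n. \<forall>\<phi>\<in>#\<mu> n. in_lang L \<phi>) \<and>
        Ps = image_mset (inst_seq \<sigma> \<mu>) (prems r) \<and> S = inst_seq \<sigma> \<mu> (concl r)) \<and>
     (\<forall>P\<in>#Ps. single_conclusion P) \<and> single_conclusion S"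

fun item_in_lang :: "'c conn set \<Rightarrow> 'c item \<Rightarrow> bool" where
  "item_in_lang L (MF \<phi>) = in_lang L \<phi>"
| "item_in_lang L (Ctx n) = True"
| "item_in_lang L (BoxCtx n) = (BoxC \<in> L)"

definition rule_in_lang :: "'c conn set \<Rightarrow> 'c rule \<Rightarrow> bool" where
  "rule_in_lang L r \<longleftrightarrow>
     (\<forall>S\<in>#add_mset (concl r) (prems r). \<forall>x\<in>#ante S + succ S. item_in_lang L x)"


section \<open>Calculi, tree-like proofs, provability\<close>

text \<open>\<open>AxExt G R\<close> is the axiomatic extension of \<open>G\<close> by the rules \<open>R\<close>.\<close>

datatype 'c calculus = Calc "'c rule set" | AxExt "'c calculus" "'c rule set"

fun calculus_in_lang :: "'c conn set \<Rightarrow> 'c calculus \<Rightarrow> bool" where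
  "calculus_in_lang L (Calc R) = (\<forall>r\<in>R. rule_in_lang L r)"
| "calculus_in_lang L (AxExt G R) = (calculus_in_lang L G \<and> (\<forall>r\<in>R. rule_in_lang L r))"

datatype 'c ptree = Node (root: "'c sequent") "'c ptree list"

inductive_set derivs :: "'c conn set \<Rightarrow> 'c ptree set \<Rightarrow> 'c rule set \<Rightarrow> 'c ptree set"
  for L :: "'c conn set" and A :: "'c ptree set" and R :: "'c rule set" where
  base: "t \<in> A \<Longrightarrow> t \<in> derivs L A R"
| step: "\<lbrakk>r \<in> R; \<forall>t\<in>set ts. t \<in> derivs L A R; rule_instance L r (mset (map root ts)) S\<rbrakk>
    \<Longrightarrow> Node S ts \<in> derivs L A R"

text \<open>
  In a proof in \<open>AxExt G R\<close> an axiom, i.e. a \<open>G\<close>-provable sequent, is justified by a \<open>G\<close>-proof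
  of it, and this \<open>G\<close>-proof is part of the proof. For provability this makes no difference
  (lemma \<open>provable_AxExt\<close> below), but it is what makes the length of a proof in \<open>AxExt G R\<close>
  account for the length of the \<open>G\<close>-proofs it rests on.
\<close>

primrec proofs :: "'c conn set \<Rightarrow> 'c calculus \<Rightarrow> 'c ptree set" where
  "proofs L (Calc R) = derivs L {} R"
| "proofs L (AxExt G R) = derivs L (proofs L G) R"

definition provable :: "'c conn set \<Rightarrow> 'c calculus \<Rightarrow> 'c sequent \<Rightarrow> bool" where
  "provable L G S \<longleftrightarrow> (\<exists>\<pi>\<in>proofs L G. root \<pi> = S)"

inductive derivable :: "'c conn set \<Rightarrow> 'c sequent set \<Rightarrow> 'c rule set \<Rightarrow> 'c sequent \<Rightarrow> bool"
  for L :: "'c conn set" and X :: "'c sequent set" and R :: "'c rule set" where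
  ax: "S \<in> X \<Longrightarrow> derivable L X R S"
| rule: "\<lbrakk>r \<in> R; rule_instance L r Ps S; \<forall>P\<in>#Ps. derivable L X R P\<rbrakk> \<Longrightarrow> derivable L X R S"

lemma derivs_iff_derivable:
  "(\<exists>\<pi>\<in>derivs L A R. root \<pi> = S) \<longleftrightarrow> derivable L (root ` A) R S"
proof
  assume "\<exists>\<pi>\<in>derivs L A R. root \<pi> = S"
  then obtain \<pi> where "\<pi> \<in> derivs L A R" "root \<pi> = S" by blast
  then show "derivable L (root ` A) R S"
  proof (induction arbitrary: S rule: derivs.induct)
    case (base t)
    then show ?case by (auto intro: derivable.ax)
  next
    case (step r ts S')
    have "\<forall>P\<in>#mset (map root ts). derivable L (root ` A) R P"
      using step.IH by auto
    then show ?case using step.hyps step.prems derivable.rule by (metis ptree.sel(1))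
  qed
next
  assume "derivable L (root ` A) R S"
  then show "\<exists>\<pi>\<in>derivs L A R. root \<pi> = S"
  proof induction
    case (ax S)
    then show ?case by (auto intro: derivs.base)
  next
    case (rule r Ps S)
    obtain Ss where Ss: "mset Ss = Ps" using ex_mset by blast
    have "\<forall>P\<in>set Ss. \<exists>\<pi>. \<pi> \<in> derivs L A R \<and> root \<pi> = P"
      using rule.IH Ss by auto
    then obtain f where f: "\<forall>P\<in>set Ss. f P \<in> derivs L A R \<and> root (f P) = P" by metis
    have "map root (map f Ss) = Ss" using f by (simp add: map_idI)
    then have "Node S (map f Ss) \<in> derivs L A R"
      using rule.hyps f Ss by (intro derivs.step[of r]) auto
    then show ?case by force
  qed
qed

lemma provable_Calc: "provable L (Calc R) S \<longleftrightarrow> derivable L {} R S"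
  using derivs_iff_derivable[of L "{}" R S] by (simp add: provable_def)

lemma provable_AxExt:
  "provable L (AxExt G R) S \<longleftrightarrow> derivable L {S. provable L G S} R S"
proof -
  have "{S. provable L G S} = root ` proofs L G" by (auto simp: provable_def)
  then show ?thesis using derivs_iff_derivable[of L "proofs L G" R S] by (simp add: provable_def)
qed

definition admissible :: "'c conn set \<Rightarrow> 'c calculus \<Rightarrow> 'c rule \<Rightarrow> bool" where
  "admissible L H r \<longleftrightarrow>
     (\<forall>Ps S. rule_instance L r Ps S \<longrightarrow> (\<forall>P\<in>#Ps. provable L H P) \<longrightarrow> provable L H S)"


section \<open>The calculus \<open>FL\<^sub>e\<close>\<close>

text \<open>Names for the schematic letters; distinct numbers denote distinct variables.\<close>

abbreviation "m\<phi> \<equiv> Var (MForm 0)"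
abbreviation "m\<psi> \<equiv> Var (MForm 1)"
abbreviation "c\<Gamma> \<equiv> Ctx 0"
abbreviation "c\<Sigma> \<equiv> Ctx 1"
abbreviation "c\<Delta> \<equiv> Ctx 2"

definition FLe_rules :: "'c rule set" where
  "FLe_rules = {
     \<comment> \<open>axioms\<close>
     Rule {#} ({#MF m\<phi>#} \<Rightarrow>\<^sub>s {#MF m\<phi>#}),
     Rule {#} ({#} \<Rightarrow>\<^sub>s {#MF One#}),
     Rule {#} ({#MF Zero#} \<Rightarrow>\<^sub>s {#}),
     Rule {#} ({#c\<Gamma>#} \<Rightarrow>\<^sub>s {#MF Top#}),
     Rule {#} ({#c\<Gamma>, MF Bot#} \<Rightarrow>\<^sub>s {#c\<Delta>#}),
     \<comment> \<open>\<open>1\<close> and \<open>0\<close>\<close>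
     Rule {#{#c\<Gamma>#} \<Rightarrow>\<^sub>s {#c\<Delta>#}#} ({#c\<Gamma>, MF One#} \<Rightarrow>\<^sub>s {#c\<Delta>#}),
     Rule {#{#c\<Gamma>#} \<Rightarrow>\<^sub>s {#}#} ({#c\<Gamma>#} \<Rightarrow>\<^sub>s {#MF Zero#}),
     \<comment> \<open>\<open>\<and>\<close>\<close>
     Rule {#{#c\<Gamma>, MF m\<phi>#} \<Rightarrow>\<^sub>s {#c\<Delta>#}#} ({#c\<Gamma>, MF (And m\<phi> m\<psi>)#} \<Rightarrow>\<^sub>s {#c\<Delta>#}),
     Rule {#{#c\<Gamma>, MF m\<psi>#} \<Rightarrow>\<^sub>s {#c\<Delta>#}#} ({#c\<Gamma>, MF (And m\<phi> m\<psi>)#} \<Rightarrow>\<^sub>s {#c\<Delta>#}),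
     Rule {#{#c\<Gamma>#} \<Rightarrow>\<^sub>s {#MF m\<phi>#}, {#c\<Gamma>#} \<Rightarrow>\<^sub>s {#MF m\<psi>#}#} ({#c\<Gamma>#} \<Rightarrow>\<^sub>s {#MF (And m\<phi> m\<psi>)#}),
     \<comment> \<open>\<open>\<or>\<close>\<close>
     Rule {#{#c\<Gamma>, MF m\<phi>#} \<Rightarrow>\<^sub>s {#c\<Delta>#}, {#c\<Gamma>, MF m\<psi>#} \<Rightarrow>\<^sub>s {#c\<Delta>#}#}
       ({#c\<Gamma>, MF (Or m\<phi> m\<psi>)#} \<Rightarrow>\<^sub>s {#c\<Delta>#}),
     Rule {#{#c\<Gamma>#} \<Rightarrow>\<^sub>s {#MF m\<phi>#}#} ({#c\<Gamma>#} \<Rightarrow>\<^sub>s {#MF (Or m\<phi> m\<psi>)#}),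
     Rule {#{#c\<Gamma>#} \<Rightarrow>\<^sub>s {#MF m\<psi>#}#} ({#c\<Gamma>#} \<Rightarrow>\<^sub>s {#MF (Or m\<phi> m\<psi>)#}),
     \<comment> \<open>\<open>*\<close>\<close>
     Rule {#{#c\<Gamma>, MF m\<phi>, MF m\<psi>#} \<Rightarrow>\<^sub>s {#c\<Delta>#}#} ({#c\<Gamma>, MF (Fus m\<phi> m\<psi>)#} \<Rightarrow>\<^sub>s {#c\<Delta>#}),
     Rule {#{#c\<Gamma>#} \<Rightarrow>\<^sub>s {#MF m\<phi>#}, {#c\<Sigma>#} \<Rightarrow>\<^sub>s {#MF m\<psi>#}#}
       ({#c\<Gamma>, c\<Sigma>#} \<Rightarrow>\<^sub>s {#MF (Fus m\<phi> m\<psi>)#}),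
     \<comment> \<open>\<open>\<rightarrow>\<close>\<close>
     Rule {#{#c\<Gamma>#} \<Rightarrow>\<^sub>s {#MF m\<phi>#}, {#c\<Sigma>, MF m\<psi>#} \<Rightarrow>\<^sub>s {#c\<Delta>#}#}
       ({#c\<Gamma>, c\<Sigma>, MF (Imp m\<phi> m\<psi>)#} \<Rightarrow>\<^sub>s {#c\<Delta>#}),
     Rule {#{#c\<Gamma>, MF m\<phi>#} \<Rightarrow>\<^sub>s {#MF m\<psi>#}#} ({#c\<Gamma>#} \<Rightarrow>\<^sub>s {#MF (Imp m\<phi> m\<psi>)#})}"

definition FLe :: "'c calculus" where
  "FLe = Calc FLe_rules"

text \<open>
  \<open>H\<close> extends \<open>FL\<^sub>e\<close>: whatever \<open>FL\<^sub>e\<close> proves, also from sequents already provable in \<open>H\<close>, is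
  provable in \<open>H\<close>; that is, the axioms and rules of \<open>FL\<^sub>e\<close> are admissible in \<open>H\<close>. Merely asking
  that the theorems of \<open>FL\<^sub>e\<close> be provable in \<open>H\<close> is too weak for interpolation to transfer. Let
  \<open>G\<close> be \<open>FL\<^sub>e\<close> and let \<open>R\<close> consist of the two left semi-analytic rules
  \<open>\<Gamma>,\<phi> \<Rightarrow> \<Delta> / \<Gamma>,\<phi>*\<psi> \<Rightarrow> \<Delta>\<close> and \<open>L\<or>\<close>. Then
  \<open>a*b, c*d, u\<or>v \<Rightarrow> ((a*(c*d))*u) \<or> (((a*b)*c)*v)\<close> is provable in \<open>AxExt G R\<close> but has no
  interpolant there for the partition \<open>a*b, c*d | u\<or>v\<close>: the obvious candidate
  \<open>(a*(c*d)) \<and> ((a*b)*c)\<close> fails because \<open>R\<and>\<close> is not admissible.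
\<close>

definition extends_FLe :: "'c conn set \<Rightarrow> 'c calculus \<Rightarrow> bool" where
  "extends_FLe L H \<longleftrightarrow> (\<forall>r\<in>FLe_rules. admissible L H r)"

lemma extends_FLe_iff:
  "extends_FLe L H \<longleftrightarrow> (\<forall>S. provable L (AxExt H FLe_rules) S \<longrightarrow> provable L H S)"
proof
  assume ext: "extends_FLe L H"
  have "provable L H S" if "derivable L {S. provable L H S} FLe_rules S" for S
    using that ext by induction (auto simp: extends_FLe_def admissible_def)
  then show "\<forall>S. provable L (AxExt H FLe_rules) S \<longrightarrow> provable L H S"
    by (simp add: provable_AxExt)
next
  assume *: "\<forall>S. provable L (AxExt H FLe_rules) S \<longrightarrow> provable L H S"
  show "extends_FLe L H"
    unfolding extends_FLe_def admissible_def
    using * by (auto simp: provable_AxExt intro: derivable.intros)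
qed

lemma extends_FLe_provable:
  assumes "extends_FLe L H" and "provable L FLe S"
  shows "provable L H S"
proof -
  have "derivable L {} FLe_rules S"
    using assms(2) by (simp add: FLe_def provable_Calc)
  then show ?thesis
    using assms(1) by induction (auto simp: extends_FLe_def admissible_def)
qed


section \<open>Semi-analytic rules\<close>

text \<open>
  In the following definitions \<open>Ps\<close> lists, for every \<open>j\<close>, the variable \<open>\<Pi>\<^sub>j\<close> together with
  the pairs of multisets \<open>\<psi>\<^sub>j\<^sub>s, \<theta>\<^sub>j\<^sub>s\<close>; \<open>Gs\<close> lists, for every \<open>i\<close>, the variables
  \<open>\<Gamma>\<^sub>i\<close>, \<open>\<Delta>\<^sub>i\<close> together with the multisets \<open>\<phi>\<^sub>i\<^sub>r\<close>, and similarly for the other kinds of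
  rules. All the lists may be empty.
\<close>

definition left_semi_analytic :: "'c rule \<Rightarrow> bool" where
  "left_semi_analytic r \<longleftrightarrow>
    (\<exists>(Ps :: (nat \<times> ('c mform multiset \<times> 'c mform multiset) list) list)
      (Gs :: (nat \<times> nat \<times> 'c mform multiset list) list) \<phi>.
      distinct (map fst Ps @ map fst Gs @ map (fst \<circ> snd) Gs) \<and>
      (\<forall>(\<Pi>, prs)\<in>set Ps. \<forall>(\<psi>s, \<theta>s)\<in>set prs. Vs \<psi>s \<union> Vs \<theta>s \<subseteq> V \<phi>) \<and>
      (\<forall>(\<Gamma>, \<Delta>, \<phi>ss)\<in>set Gs. \<forall>\<phi>s\<in>set \<phi>ss. Vs \<phi>s \<subseteq> V \<phi>) \<and>
      prems r =
        mset (concat (map (\<lambda>(\<Pi>, prs). map (\<lambda>(\<psi>s, \<theta>s).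
          add_mset (Ctx \<Pi>) (image_mset MF \<psi>s) \<Rightarrow>\<^sub>s image_mset MF \<theta>s) prs) Ps)) +
        mset (concat (map (\<lambda>(\<Gamma>, \<Delta>, \<phi>ss). map (\<lambda>\<phi>s.
          add_mset (Ctx \<Gamma>) (image_mset MF \<phi>s) \<Rightarrow>\<^sub>s {#Ctx \<Delta>#}) \<phi>ss) Gs)) \<and>
      concl r =
        (mset (map (\<lambda>(\<Pi>, prs). Ctx \<Pi>) Ps) + mset (map (\<lambda>(\<Gamma>, \<Delta>, \<phi>ss). Ctx \<Gamma>) Gs) + {#MF \<phi>#}
         \<Rightarrow>\<^sub>s mset (map (\<lambda>(\<Gamma>, \<Delta>, \<phi>ss). Ctx \<Delta>) Gs)))"

definition right_semi_analytic :: "'c rule \<Rightarrow> bool" where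
  "right_semi_analytic r \<longleftrightarrow>
    (\<exists>(Gs :: (nat \<times> ('c mform multiset \<times> 'c mform multiset) list) list) \<phi>.
      distinct (map fst Gs) \<and>
      (\<forall>(\<Gamma>, prs)\<in>set Gs. \<forall>(\<phi>s, \<psi>s)\<in>set prs. Vs \<phi>s \<union> Vs \<psi>s \<subseteq> V \<phi>) \<and>
      prems r =
        mset (concat (map (\<lambda>(\<Gamma>, prs). map (\<lambda>(\<phi>s, \<psi>s).
          add_mset (Ctx \<Gamma>) (image_mset MF \<phi>s) \<Rightarrow>\<^sub>s image_mset MF \<psi>s) prs) Gs)) \<and>
      concl r = (mset (map (\<lambda>(\<Gamma>, prs). Ctx \<Gamma>) Gs) \<Rightarrow>\<^sub>s {#MF \<phi>#}))"

definition context_sharing_semi_analytic :: "'c rule \<Rightarrow> bool" where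
  "context_sharing_semi_analytic r \<longleftrightarrow>
    (\<exists>(Gs :: (nat \<times> nat \<times> ('c mform multiset \<times> 'c mform multiset) list \<times>
        'c mform multiset list) list) \<phi>.
      distinct (map fst Gs @ map (fst \<circ> snd) Gs) \<and>
      (\<forall>(\<Gamma>, \<Delta>, prs, \<phi>ss)\<in>set Gs.
        (\<forall>(\<psi>s, \<theta>s)\<in>set prs. Vs \<psi>s \<union> Vs \<theta>s \<subseteq> V \<phi>) \<and> (\<forall>\<phi>s\<in>set \<phi>ss. Vs \<phi>s \<subseteq> V \<phi>)) \<and>
      prems r =
        mset (concat (map (\<lambda>(\<Gamma>, \<Delta>, prs, \<phi>ss). map (\<lambda>(\<psi>s, \<theta>s).
          add_mset (Ctx \<Gamma>) (image_mset MF \<psi>s) \<Rightarrow>\<^sub>s image_mset MF \<theta>s) prs) Gs)) +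
        mset (concat (map (\<lambda>(\<Gamma>, \<Delta>, prs, \<phi>ss). map (\<lambda>\<phi>s.
          add_mset (Ctx \<Gamma>) (image_mset MF \<phi>s) \<Rightarrow>\<^sub>s {#Ctx \<Delta>#}) \<phi>ss) Gs)) \<and>
      concl r =
        (mset (map (\<lambda>(\<Gamma>, \<Delta>, prs, \<phi>ss). Ctx \<Gamma>) Gs) + {#MF \<phi>#}
         \<Rightarrow>\<^sub>s mset (map (\<lambda>(\<Gamma>, \<Delta>, prs, \<phi>ss). Ctx \<Delta>) Gs)))"

text \<open>The modal rules, up to the choice of the schematic letters.\<close>

definition rule_K :: "'c rule \<Rightarrow> bool" where
  "rule_K r \<longleftrightarrow> (\<exists>\<Gamma> n. r = Rule {#{#Ctx \<Gamma>#} \<Rightarrow>\<^sub>s {#MF (Var (MForm n))#}#}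
     ({#BoxCtx \<Gamma>#} \<Rightarrow>\<^sub>s {#MF (Box (Var (MForm n)))#}))"

definition rule_D :: "'c rule \<Rightarrow> bool" where
  "rule_D r \<longleftrightarrow> (\<exists>\<Gamma>. r = Rule {#{#Ctx \<Gamma>#} \<Rightarrow>\<^sub>s {#}#} ({#BoxCtx \<Gamma>#} \<Rightarrow>\<^sub>s {#}))"

definition rule_RS4 :: "'c rule \<Rightarrow> bool" where
  "rule_RS4 r \<longleftrightarrow> (\<exists>\<Gamma> n. r = Rule {#{#BoxCtx \<Gamma>#} \<Rightarrow>\<^sub>s {#MF (Var (MForm n))#}#}
     ({#BoxCtx \<Gamma>#} \<Rightarrow>\<^sub>s {#MF (Box (Var (MForm n)))#}))"

definition rule_LS4 :: "'c rule \<Rightarrow> bool" where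
  "rule_LS4 r \<longleftrightarrow> (\<exists>\<Gamma> \<Delta> n. \<Gamma> \<noteq> \<Delta> \<and>
     r = Rule {#{#Ctx \<Gamma>, MF (Var (MForm n))#} \<Rightarrow>\<^sub>s {#Ctx \<Delta>#}#}
       ({#Ctx \<Gamma>, MF (Box (Var (MForm n)))#} \<Rightarrow>\<^sub>s {#Ctx \<Delta>#}))"

definition rule_4 :: "'c rule \<Rightarrow> bool" where
  "rule_4 r \<longleftrightarrow> (\<exists>\<Gamma> n. r = Rule {#{#BoxCtx \<Gamma>, Ctx \<Gamma>#} \<Rightarrow>\<^sub>s {#MF (Var (MForm n))#}#}
     ({#BoxCtx \<Gamma>#} \<Rightarrow>\<^sub>s {#MF (Box (Var (MForm n)))#}))"

definition rule_4D :: "'c rule \<Rightarrow> bool" where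
  "rule_4D r \<longleftrightarrow> (\<exists>\<Gamma>. r = Rule {#{#BoxCtx \<Gamma>, Ctx \<Gamma>#} \<Rightarrow>\<^sub>s {#}#} ({#BoxCtx \<Gamma>#} \<Rightarrow>\<^sub>s {#}))"

text \<open>\<open>LS4\<close> needs no disjunct of its own, being a left semi-analytic rule.\<close>

definition semi_analytic :: "'c rule \<Rightarrow> bool" where
  "semi_analytic r \<longleftrightarrow> left_semi_analytic r \<or> right_semi_analytic r \<or>
     rule_K r \<or> rule_D r \<or> rule_RS4 r"

text \<open>The side conditions ``only with'' on the presence of modal rules in a set of rules.\<close>

definition modal_compatible :: "'c rule set \<Rightarrow> bool" where
  "modal_compatible R \<longleftrightarrow>
     ((\<exists>r\<in>R. rule_D r) \<longrightarrow> (\<exists>r\<in>R. rule_K r)) \<and>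
     ((\<exists>r\<in>R. rule_RS4 r) \<longrightarrow> (\<exists>r\<in>R. rule_LS4 r)) \<and>
     ((\<exists>r\<in>R. rule_4D r) \<longrightarrow> (\<exists>r\<in>R. rule_4 r))"

definition left_weakening_boxed :: "'c rule" where
  "left_weakening_boxed = Rule {#{#c\<Gamma>#} \<Rightarrow>\<^sub>s {#c\<Delta>#}#} ({#c\<Gamma>, MF (Box m\<phi>)#} \<Rightarrow>\<^sub>s {#c\<Delta>#})"

definition left_weakening :: "'c rule" where
  "left_weakening = Rule {#{#c\<Gamma>#} \<Rightarrow>\<^sub>s {#c\<Delta>#}#} ({#c\<Gamma>, MF m\<phi>#} \<Rightarrow>\<^sub>s {#c\<Delta>#})"

definition right_weakening :: "'c rule" where
  "right_weakening = Rule {#{#c\<Gamma>#} \<Rightarrow>\<^sub>s {#}#} ({#c\<Gamma>#} \<Rightarrow>\<^sub>s {#MF m\<phi>#})"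

definition context_sharing_left_imp :: "'c rule" where
  "context_sharing_left_imp =
     Rule {#{#c\<Gamma>#} \<Rightarrow>\<^sub>s {#MF m\<phi>#}, {#c\<Gamma>, MF m\<psi>#} \<Rightarrow>\<^sub>s {#c\<Delta>#}#}
       ({#c\<Gamma>, MF (Imp m\<phi> m\<psi>)#} \<Rightarrow>\<^sub>s {#c\<Delta>#})"


section \<open>Encoding length and interpolation\<close>

text \<open>
  Formulas are written in prefix notation, the index of an atom in binary; the formulas of a sequent
  are terminated by a separator, and a proof is written as a term over its sequents.
\<close>

fun form_length :: "'c form \<Rightarrow> nat" where
  "form_length (Var p) = Suc (Suc (floor_log p))"
| "form_length One = 1"
| "form_length Zero = 1"
| "form_length Top = 1"
| "form_length Bot = 1"
| "form_length (And \<phi> \<psi>) = Suc (form_length \<phi> + form_length \<psi>)"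
| "form_length (Or \<phi> \<psi>) = Suc (form_length \<phi> + form_length \<psi>)"
| "form_length (Fus \<phi> \<psi>) = Suc (form_length \<phi> + form_length \<psi>)"
| "form_length (Imp \<phi> \<psi>) = Suc (form_length \<phi> + form_length \<psi>)"
| "form_length (Op k \<phi>s) = Suc (sum_list (map form_length \<phi>s))"

definition seq_length :: "'c sequent \<Rightarrow> nat" where
  "seq_length S = Suc (\<Sum>\<phi>\<in>#ante S + succ S. Suc (form_length \<phi>))"

fun proof_length :: "'c ptree \<Rightarrow> nat" where
  "proof_length (Node S ts) = Suc (seq_length S + sum_list (map proof_length ts))"

definition interpolant ::
  "'c conn set \<Rightarrow> 'c calculus \<Rightarrow> 'c form multiset \<Rightarrow> 'c form multiset \<Rightarrow> 'c form multiset \<Rightarrow>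
   'c form \<Rightarrow> bool" where
  "interpolant L H \<Sigma> \<Lambda> \<Delta> C \<longleftrightarrow>
     in_lang L C \<and> provable L H (\<Sigma> \<Rightarrow>\<^sub>s {#C#}) \<and> provable L H (\<Lambda> + {#C#} \<Rightarrow>\<^sub>s \<Delta>) \<and>
     V C \<subseteq> Vs \<Sigma> \<inter> Vs (\<Lambda> + \<Delta>)"

definition has_interpolation :: "'c conn set \<Rightarrow> 'c calculus \<Rightarrow> 'c calculus \<Rightarrow> bool" where
  "has_interpolation L G H \<longleftrightarrow>
     (\<forall>\<pi>\<in>proofs L G. \<forall>\<Sigma> \<Lambda> \<Delta>. root \<pi> = (\<Sigma> + \<Lambda> \<Rightarrow>\<^sub>s \<Delta>) \<longrightarrow> (\<exists>C. interpolant L H \<Sigma> \<Lambda> \<Delta> C))"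

text \<open>Since \<open>proof_length \<pi> \<ge> 2\<close>, a bound \<open>c * proof_length \<pi> ^ k + c\<close> is subsumed.\<close>

definition has_feasible_interpolation ::
  "'c conn set \<Rightarrow> 'c calculus \<Rightarrow> 'c calculus \<Rightarrow> bool" where
  "has_feasible_interpolation L G H \<longleftrightarrow>
     (\<exists>k::nat. \<forall>\<pi>\<in>proofs L G. \<forall>\<Sigma> \<Lambda> \<Delta>. root \<pi> = (\<Sigma> + \<Lambda> \<Rightarrow>\<^sub>s \<Delta>) \<longrightarrow>
        (\<exists>C. interpolant L H \<Sigma> \<Lambda> \<Delta> C \<and> form_length C \<le> proof_length \<pi> ^ k))"

end

theory Submission
  imports Defs
begin

text \<open>
  Maehara's method, without cut. By induction on the \<open>H\<close>-proof, an interpolant for a partition of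
  the conclusion of a rule is assembled from one interpolant for each premise. If the principal
  formula belongs to \<open>\<Lambda>\<close> or to the succedent, the interpolants of the premises sharing a
  context are joined by \<open>\<and>\<close>, and the results for the different contexts by \<open>*\<close>. If it belongs to
  \<open>\<Sigma>\<close>, the roles of the two sides are exchanged for all premises except those that carry
  the succedent; the former yield a formula \<open>E\<close> as before, the latter are joined by \<open>\<or>\<close> to a formula
  \<open>C\<close>, and the interpolant is \<open>E \<rightarrow> C\<close> (or \<open>E \<rightarrow> 0\<close> if the succedent is empty). Replacing the
  contexts by the parts of the partition and these formulas gives instances of the same rule, since
  its contexts are independent schematic variables. For a modal rule, \<open>\<box>C\<close> is the interpolant.
  Every premise is used once and contributes only constant overhead, so the length of the
  interpolant stays polynomial in the length of the tree-like proof.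
\<close>

section \<open>Derived rules of extensions of \<open>FL\<^sub>e\<close>\<close>

abbreviation langs :: "'c conn set \<Rightarrow> ('a, 'c) fm multiset \<Rightarrow> bool" where
  "langs L M \<equiv> \<forall>\<phi>\<in>#M. in_lang L \<phi>"

definition wf_seq :: "'c conn set \<Rightarrow> 'c sequent \<Rightarrow> bool" where
  "wf_seq L S \<longleftrightarrow> langs L (ante S + succ S) \<and> single_conclusion S"

lemma in_lang_inst_form:
  assumes "\<forall>n. in_lang L (\<sigma> n)" and "in_lang L \<phi>"
  shows "in_lang L (inst_form \<sigma> \<phi>)"
  using assms(2)
proof (induction \<phi>)
  case (Var x)
  then show ?case using assms(1) by (cases x) auto
qed auto

lemma V_inst_form:
  "V (inst_form \<sigma> \<phi>) = (\<Union>x\<in>V \<phi>. case x of MAtom p \<Rightarrow> {p} | MForm n \<Rightarrow> V (\<sigma> n))"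
proof (induction \<phi>)
  case (Var x)
  then show ?case by (cases x) auto
qed auto

lemma Vs_inst_form_mono:
  assumes "Vs M \<subseteq> Vs N"
  shows "Vs (image_mset (inst_form \<sigma>) M) \<subseteq> Vs (image_mset (inst_form \<sigma>) N)"
  using assms unfolding Vs_def by (simp add: V_inst_form) blast

lemma Vs_union [simp]: "Vs (M + N) = Vs M \<union> Vs N"
  and Vs_add_mset [simp]: "Vs (add_mset \<phi> M) = V \<phi> \<union> Vs M"
  and Vs_empty [simp]: "Vs {#} = {}"
  by (auto simp: Vs_def)

lemma Vs_image_Box [simp]: "Vs (image_mset Box M) = Vs M"
  by (auto simp: Vs_def)

lemma Vs_sum: "finite I \<Longrightarrow> Vs (\<Sum>i\<in>I. M i) = (\<Union>i\<in>I. Vs (M i))"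
  by (simp add: Vs_def set_mset_sum)

lemma langs_inst_item:
  assumes "\<forall>n. in_lang L (\<sigma> n)" and "\<forall>n. langs L (\<mu> n)" and "item_in_lang L x"
  shows "langs L (inst_item \<sigma> \<mu> x)"
  using assms by (cases x) (auto intro: in_lang_inst_form)

lemma wf_seq_rule_instance:
  assumes "rule_in_lang L r" and "rule_instance L r Ps S"
  shows "wf_seq L S"
proof -
  obtain \<sigma> \<mu> where in_lang: "\<forall>n. in_lang L (\<sigma> n)" "\<forall>n. langs L (\<mu> n)"
    and "S = inst_seq \<sigma> \<mu> (concl r)" "single_conclusion S"
    using assms(2) unfolding rule_instance_def by blast
  then show ?thesis
    using assms(1) langs_inst_item[OF in_lang]
    by (fastforce simp: wf_seq_def rule_in_lang_def inst_seq_def single_conclusion_def)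
qed

lemma wf_seq_root_derivs:
  assumes "t \<in> derivs L A R" and "\<forall>t\<in>A. wf_seq L (root t)" and "\<forall>r\<in>R. rule_in_lang L r"
  shows "wf_seq L (root t)"
  using assms by induction (auto intro: wf_seq_rule_instance)

lemma wf_seq_root_proofs:
  "calculus_in_lang L G \<Longrightarrow> t \<in> proofs L G \<Longrightarrow> wf_seq L (root t)"
  by (induction G arbitrary: t) (auto intro: wf_seq_root_derivs)

lemma wf_seq_provable:
  "calculus_in_lang L G \<Longrightarrow> provable L G S \<Longrightarrow> wf_seq L S"
  by (auto simp: provable_def wf_seq_root_proofs)

lemma admissibleD:
  assumes "admissible L H r" and "\<forall>n. in_lang L (\<sigma> n)" and "\<forall>n. langs L (\<mu> n)"
    and "calculus_in_lang L H"
    and "\<forall>P\<in>#prems r. provable L H (inst_seq \<sigma> \<mu> P)"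
    and "single_conclusion (inst_seq \<sigma> \<mu> (concl r))"
  shows "provable L H (inst_seq \<sigma> \<mu> (concl r))"
proof -
  have "rule_instance L r (image_mset (inst_seq \<sigma> \<mu>) (prems r)) (inst_seq \<sigma> \<mu> (concl r))"
    using assms wf_seq_provable[OF assms(4)]
    by (auto simp: rule_instance_def wf_seq_def single_conclusion_def)
  then show ?thesis using assms(1,5) by (auto simp: admissible_def)
qed

definition big_and :: "('a, 'c) fm list \<Rightarrow> ('a, 'c) fm" where
  "big_and Cs = foldr And Cs Top"

definition big_or :: "('a, 'c) fm list \<Rightarrow> ('a, 'c) fm" where
  "big_or Cs = foldr Or Cs Bot"

lemma big_simps [simp]:
  "big_and [] = Top" "big_and (C # Cs) = And C (big_and Cs)"
  "big_or [] = Bot" "big_or (C # Cs) = Or C (big_or Cs)"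
  by (simp_all add: big_and_def big_or_def)

lemma in_lang_big [simp]:
  "in_lang L (big_and Cs) \<longleftrightarrow> (\<forall>C\<in>set Cs. in_lang L C)"
  "in_lang L (big_or Cs) \<longleftrightarrow> (\<forall>C\<in>set Cs. in_lang L C)"
  by (induction Cs) auto

lemma V_big [simp]:
  "V (big_and Cs) = (\<Union>C\<in>set Cs. V C)"
  "V (big_or Cs) = (\<Union>C\<in>set Cs. V C)"
  by (induction Cs) auto

locale FLe_extension =
  fixes L :: "'c conn set" and H :: "'c calculus"
  assumes lang_H: "calculus_in_lang L H" and ext_H: "extends_FLe L H"
begin

abbreviation prv :: "'c form multiset \<Rightarrow> 'c form multiset \<Rightarrow> bool" (infix "\<turnstile>" 45) where
  "\<Gamma> \<turnstile> \<Delta> \<equiv> provable L H (\<Gamma> \<Rightarrow>\<^sub>s \<Delta>)"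

lemma prvD:
  assumes "\<Gamma> \<turnstile> \<Delta>"
  shows "langs L \<Gamma>" "langs L \<Delta>" "size \<Delta> \<le> Suc 0"
  using wf_seq_provable[OF lang_H assms] by (auto simp: wf_seq_def single_conclusion_def)

lemma admissible_inst:
  assumes "admissible L H r" and "in_lang L \<phi>" "in_lang L \<psi>" "langs L \<Gamma>" "langs L \<Pi>" "langs L \<Delta>"
  defines "\<sigma> \<equiv> \<lambda>n::nat. if n = 0 then \<phi> else \<psi>"
    and "\<mu> \<equiv> \<lambda>n::nat. if n = 0 then \<Gamma> else if n = 1 then \<Pi> else \<Delta>"
  assumes "\<forall>P\<in>#prems r. provable L H (inst_seq \<sigma> \<mu> P)"
    and "single_conclusion (inst_seq \<sigma> \<mu> (concl r))"
  shows "provable L H (inst_seq \<sigma> \<mu> (concl r))"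
  using assms by (intro admissibleD) (auto simp: lang_H)

lemmas FLe_inst = admissible_inst[OF ext_H[unfolded extends_FLe_def, rule_format]]

lemmas inst_simps = inst_seq_def single_conclusion_def

lemma prv_OneR: "{#} \<turnstile> {#One#}"
  using FLe_inst[of "Rule {#} ({#} \<Rightarrow>\<^sub>s {#MF One#})" One One "{#}" "{#}" "{#}"]
  by (simp add: FLe_rules_def inst_simps)

lemma prv_ZeroL: "{#Zero#} \<turnstile> {#}"
  using FLe_inst[of "Rule {#} ({#MF Zero#} \<Rightarrow>\<^sub>s {#})" One One "{#}" "{#}" "{#}"]
  by (simp add: FLe_rules_def inst_simps)

lemma prv_TopR: "langs L \<Gamma> \<Longrightarrow> \<Gamma> \<turnstile> {#Top#}"
  using FLe_inst[of "Rule {#} ({#c\<Gamma>#} \<Rightarrow>\<^sub>s {#MF Top#})" One One \<Gamma> "{#}" "{#}"]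
  by (simp add: FLe_rules_def inst_simps)

lemma prv_BotL: "langs L \<Gamma> \<Longrightarrow> langs L \<Delta> \<Longrightarrow> size \<Delta> \<le> 1 \<Longrightarrow> add_mset Bot \<Gamma> \<turnstile> \<Delta>"
  using FLe_inst[of "Rule {#} ({#c\<Gamma>, MF Bot#} \<Rightarrow>\<^sub>s {#c\<Delta>#})" One One \<Gamma> "{#}" \<Delta>]
  by (simp add: FLe_rules_def inst_simps)

lemma prv_OneL: "\<Gamma> \<turnstile> \<Delta> \<Longrightarrow> add_mset One \<Gamma> \<turnstile> \<Delta>"
  using FLe_inst[of "Rule {#{#c\<Gamma>#} \<Rightarrow>\<^sub>s {#c\<Delta>#}#} ({#c\<Gamma>, MF One#} \<Rightarrow>\<^sub>s {#c\<Delta>#})"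
      One One \<Gamma> "{#}" \<Delta>]
  by (simp add: FLe_rules_def inst_simps prvD)

lemma prv_ZeroR: "\<Gamma> \<turnstile> {#} \<Longrightarrow> \<Gamma> \<turnstile> {#Zero#}"
  using FLe_inst[of "Rule {#{#c\<Gamma>#} \<Rightarrow>\<^sub>s {#}#} ({#c\<Gamma>#} \<Rightarrow>\<^sub>s {#MF Zero#})" One One \<Gamma> "{#}" "{#}"]
  by (simp add: FLe_rules_def inst_simps prvD)

lemma prv_AndL1: "add_mset \<phi> \<Gamma> \<turnstile> \<Delta> \<Longrightarrow> in_lang L \<psi> \<Longrightarrow> add_mset (And \<phi> \<psi>) \<Gamma> \<turnstile> \<Delta>"
  using FLe_inst[of "Rule {#{#c\<Gamma>, MF m\<phi>#} \<Rightarrow>\<^sub>s {#c\<Delta>#}#} ({#c\<Gamma>, MF (And m\<phi> m\<psi>)#} \<Rightarrow>\<^sub>s {#c\<Delta>#})"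
      \<phi> \<psi> \<Gamma> "{#}" \<Delta>] prvD[of "add_mset \<phi> \<Gamma>" \<Delta>]
  by (simp add: FLe_rules_def inst_simps)

lemma prv_AndL2: "add_mset \<psi> \<Gamma> \<turnstile> \<Delta> \<Longrightarrow> in_lang L \<phi> \<Longrightarrow> add_mset (And \<phi> \<psi>) \<Gamma> \<turnstile> \<Delta>"
  using FLe_inst[of "Rule {#{#c\<Gamma>, MF m\<psi>#} \<Rightarrow>\<^sub>s {#c\<Delta>#}#} ({#c\<Gamma>, MF (And m\<phi> m\<psi>)#} \<Rightarrow>\<^sub>s {#c\<Delta>#})"
      \<phi> \<psi> \<Gamma> "{#}" \<Delta>] prvD[of "add_mset \<psi> \<Gamma>" \<Delta>]
  by (simp add: FLe_rules_def inst_simps)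

lemma prv_AndR: "\<Gamma> \<turnstile> {#\<phi>#} \<Longrightarrow> \<Gamma> \<turnstile> {#\<psi>#} \<Longrightarrow> \<Gamma> \<turnstile> {#And \<phi> \<psi>#}"
  using FLe_inst[of "Rule {#{#c\<Gamma>#} \<Rightarrow>\<^sub>s {#MF m\<phi>#}, {#c\<Gamma>#} \<Rightarrow>\<^sub>s {#MF m\<psi>#}#}
      ({#c\<Gamma>#} \<Rightarrow>\<^sub>s {#MF (And m\<phi> m\<psi>)#})" \<phi> \<psi> \<Gamma> "{#}" "{#}"]
    prvD[of \<Gamma> "{#\<phi>#}"] prvD[of \<Gamma> "{#\<psi>#}"]
  by (simp add: FLe_rules_def inst_simps)

lemma prv_OrL: "add_mset \<phi> \<Gamma> \<turnstile> \<Delta> \<Longrightarrow> add_mset \<psi> \<Gamma> \<turnstile> \<Delta> \<Longrightarrow> add_mset (Or \<phi> \<psi>) \<Gamma> \<turnstile> \<Delta>"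
  using FLe_inst[of "Rule {#{#c\<Gamma>, MF m\<phi>#} \<Rightarrow>\<^sub>s {#c\<Delta>#}, {#c\<Gamma>, MF m\<psi>#} \<Rightarrow>\<^sub>s {#c\<Delta>#}#}
      ({#c\<Gamma>, MF (Or m\<phi> m\<psi>)#} \<Rightarrow>\<^sub>s {#c\<Delta>#})" \<phi> \<psi> \<Gamma> "{#}" \<Delta>]
    prvD[of "add_mset \<phi> \<Gamma>" \<Delta>] prvD[of "add_mset \<psi> \<Gamma>" \<Delta>]
  by (simp add: FLe_rules_def inst_simps)

lemma prv_OrR1: "\<Gamma> \<turnstile> {#\<phi>#} \<Longrightarrow> in_lang L \<psi> \<Longrightarrow> \<Gamma> \<turnstile> {#Or \<phi> \<psi>#}"
  using FLe_inst[of "Rule {#{#c\<Gamma>#} \<Rightarrow>\<^sub>s {#MF m\<phi>#}#} ({#c\<Gamma>#} \<Rightarrow>\<^sub>s {#MF (Or m\<phi> m\<psi>)#})"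
      \<phi> \<psi> \<Gamma> "{#}" "{#}"] prvD[of \<Gamma> "{#\<phi>#}"]
  by (simp add: FLe_rules_def inst_simps)

lemma prv_OrR2: "\<Gamma> \<turnstile> {#\<psi>#} \<Longrightarrow> in_lang L \<phi> \<Longrightarrow> \<Gamma> \<turnstile> {#Or \<phi> \<psi>#}"
  using FLe_inst[of "Rule {#{#c\<Gamma>#} \<Rightarrow>\<^sub>s {#MF m\<psi>#}#} ({#c\<Gamma>#} \<Rightarrow>\<^sub>s {#MF (Or m\<phi> m\<psi>)#})"
      \<phi> \<psi> \<Gamma> "{#}" "{#}"] prvD[of \<Gamma> "{#\<psi>#}"]
  by (simp add: FLe_rules_def inst_simps)

lemma prv_FusL: "add_mset \<phi> (add_mset \<psi> \<Gamma>) \<turnstile> \<Delta> \<Longrightarrow> add_mset (Fus \<phi> \<psi>) \<Gamma> \<turnstile> \<Delta>"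
  using FLe_inst[of "Rule {#{#c\<Gamma>, MF m\<phi>, MF m\<psi>#} \<Rightarrow>\<^sub>s {#c\<Delta>#}#}
      ({#c\<Gamma>, MF (Fus m\<phi> m\<psi>)#} \<Rightarrow>\<^sub>s {#c\<Delta>#})" \<phi> \<psi> \<Gamma> "{#}" \<Delta>]
    prvD[of "add_mset \<phi> (add_mset \<psi> \<Gamma>)" \<Delta>]
  by (simp add: FLe_rules_def inst_simps add_mset_commute)

lemma prv_FusR: "\<Gamma> \<turnstile> {#\<phi>#} \<Longrightarrow> \<Pi> \<turnstile> {#\<psi>#} \<Longrightarrow> \<Gamma> + \<Pi> \<turnstile> {#Fus \<phi> \<psi>#}"
  using FLe_inst[of "Rule {#{#c\<Gamma>#} \<Rightarrow>\<^sub>s {#MF m\<phi>#}, {#c\<Sigma>#} \<Rightarrow>\<^sub>s {#MF m\<psi>#}#}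
      ({#c\<Gamma>, c\<Sigma>#} \<Rightarrow>\<^sub>s {#MF (Fus m\<phi> m\<psi>)#})" \<phi> \<psi> \<Gamma> \<Pi> "{#}"]
    prvD[of \<Gamma> "{#\<phi>#}"] prvD[of \<Pi> "{#\<psi>#}"]
  by (simp add: FLe_rules_def inst_simps)

lemma prv_ImpL: "\<Gamma> \<turnstile> {#\<phi>#} \<Longrightarrow> add_mset \<psi> \<Pi> \<turnstile> \<Delta> \<Longrightarrow> add_mset (Imp \<phi> \<psi>) (\<Gamma> + \<Pi>) \<turnstile> \<Delta>"
  using FLe_inst[of "Rule {#{#c\<Gamma>#} \<Rightarrow>\<^sub>s {#MF m\<phi>#}, {#c\<Sigma>, MF m\<psi>#} \<Rightarrow>\<^sub>s {#c\<Delta>#}#}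
      ({#c\<Gamma>, c\<Sigma>, MF (Imp m\<phi> m\<psi>)#} \<Rightarrow>\<^sub>s {#c\<Delta>#})" \<phi> \<psi> \<Gamma> \<Pi> \<Delta>]
    prvD[of \<Gamma> "{#\<phi>#}"] prvD[of "add_mset \<psi> \<Pi>" \<Delta>]
  by (simp add: FLe_rules_def inst_simps)

lemma prv_ImpR: "add_mset \<phi> \<Gamma> \<turnstile> {#\<psi>#} \<Longrightarrow> \<Gamma> \<turnstile> {#Imp \<phi> \<psi>#}"
  using FLe_inst[of "Rule {#{#c\<Gamma>, MF m\<phi>#} \<Rightarrow>\<^sub>s {#MF m\<psi>#}#} ({#c\<Gamma>#} \<Rightarrow>\<^sub>s {#MF (Imp m\<phi> m\<psi>)#})"
      \<phi> \<psi> \<Gamma> "{#}" "{#}"] prvD[of "add_mset \<phi> \<Gamma>" "{#\<psi>#}"]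
  by (simp add: FLe_rules_def inst_simps)

lemma prv_weaken_Box:
  assumes "admissible L H left_weakening_boxed" and "\<Gamma> \<turnstile> \<Delta>" and "in_lang L \<phi>"
  shows "add_mset (Box \<phi>) \<Gamma> \<turnstile> \<Delta>"
  using admissible_inst[OF assms(1), of \<phi> \<phi> \<Gamma> "{#}" \<Delta>] assms prvD[OF assms(2)]
  by (simp add: left_weakening_boxed_def inst_simps)

lemma prv_weaken:
  assumes "admissible L H left_weakening" and "\<Gamma> \<turnstile> \<Delta>" and "langs L \<Pi>"
  shows "\<Gamma> + \<Pi> \<turnstile> \<Delta>"
  using assms(3)
proof (induction \<Pi>)
  case empty
  then show ?case using assms(2) by simp
next
  case (add \<phi> \<Pi>)
  then have weakened: "\<Gamma> + \<Pi> \<turnstile> \<Delta>" by simp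
  show ?case
    using admissible_inst[OF assms(1), of \<phi> \<phi> "\<Gamma> + \<Pi>" "{#}" \<Delta>] prvD[OF weakened] weakened
      add.prems
    by (simp add: left_weakening_def inst_simps)
qed

lemma prv_ImpL_shared:
  assumes "admissible L H context_sharing_left_imp" and "\<Gamma> \<turnstile> {#\<phi>#}" and "add_mset \<psi> \<Gamma> \<turnstile> \<Delta>"
  shows "add_mset (Imp \<phi> \<psi>) \<Gamma> \<turnstile> \<Delta>"
  using admissible_inst[OF assms(1), of \<phi> \<psi> \<Gamma> "{#}" \<Delta>] assms(2,3) prvD[OF assms(2)]
    prvD[OF assms(3)]
  by (simp add: context_sharing_left_imp_def inst_simps)

lemma prv_big_andR:
  assumes "langs L \<Gamma>" and "\<forall>C\<in>set Cs. \<Gamma> \<turnstile> {#C#}"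
  shows "\<Gamma> \<turnstile> {#big_and Cs#}"
  using assms(2) by (induction Cs) (use assms(1) in \<open>auto intro: prv_TopR prv_AndR\<close>)

lemma prv_big_andL:
  assumes "C \<in> set Cs" and "\<forall>C\<in>set Cs. in_lang L C" and "add_mset C \<Gamma> \<turnstile> \<Delta>"
  shows "add_mset (big_and Cs) \<Gamma> \<turnstile> \<Delta>"
  using assms(1,2) by (induction Cs) (auto intro: prv_AndL1 prv_AndL2 assms(3))

lemma prv_big_orL:
  assumes "langs L \<Gamma>" "langs L \<Delta>" "size \<Delta> \<le> 1" and "\<forall>C\<in>set Cs. add_mset C \<Gamma> \<turnstile> \<Delta>"
  shows "add_mset (big_or Cs) \<Gamma> \<turnstile> \<Delta>"
  using assms(4) by (induction Cs) (use assms(1-3) in \<open>auto intro: prv_BotL prv_OrL\<close>)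

lemma prv_big_orR:
  assumes "C \<in> set Cs" and "\<forall>C\<in>set Cs. in_lang L C" and "\<Gamma> \<turnstile> {#C#}"
  shows "\<Gamma> \<turnstile> {#big_or Cs#}"
  using assms(1,2) by (induction Cs) (auto intro: prv_OrR1 prv_OrR2 assms(3))

lemma interpolant_iff:
  "interpolant L H \<Sigma> \<Lambda> \<Delta> C \<longleftrightarrow>
     \<Sigma> \<turnstile> {#C#} \<and> add_mset C \<Lambda> \<turnstile> \<Delta> \<and> V C \<subseteq> Vs \<Sigma> \<inter> (Vs \<Lambda> \<union> Vs \<Delta>)"
  using prvD(2)[of \<Sigma> "{#C#}"] by (auto simp: interpolant_def)

lemma interpolant_swap:
  assumes "interpolant L H \<Lambda> \<Sigma> {#} C"
  shows "interpolant L H \<Sigma> \<Lambda> {#} (Imp C Zero)"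
  using assms prv_ImpL[of \<Lambda> C Zero "{#}" "{#}"] prv_ZeroL
  by (auto simp: interpolant_iff intro: prv_ImpR prv_ZeroR)

end

section \<open>Interpolants of bounded weight\<close>

text \<open>
  Plain and feasible interpolation are treated at once: the weight is the length of a formula for
  feasible interpolation, and \<open>0\<close> for plain interpolation, where no bound is available.
\<close>

locale formula_weight =
  fixes w :: "'c form \<Rightarrow> nat"
  assumes weight_constant: "w One \<le> 1" "w Zero \<le> 1" "w Top \<le> 1" "w Bot \<le> 1"
    and weight_binary: "w (And C D) \<le> Suc (w C + w D)" "w (Or C D) \<le> Suc (w C + w D)"
      "w (Fus C D) \<le> Suc (w C + w D)" "w (Imp C D) \<le> Suc (w C + w D)"
    and weight_Box: "w (Box C) \<le> Suc (w C)"
begin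

lemma weight_big:
  "w (big_and Cs) \<le> (\<Sum>C\<leftarrow>Cs. Suc (w C)) + 1"
  "w (big_or Cs) \<le> (\<Sum>C\<leftarrow>Cs. Suc (w C)) + 1"
proof (induction Cs)
  case (Cons C Cs)
  case 1 show ?case using Cons(1) weight_binary(1)[of C "big_and Cs"] by simp
  case 2 show ?case using Cons(2) weight_binary(2)[of C "big_or Cs"] by simp
qed (use weight_constant in simp_all)

end

lemma formula_weight_zero: "formula_weight (\<lambda>_. 0)"
  and formula_weight_form_length: "formula_weight form_length"
  by unfold_locales auto

definition interpolable_within ::
  "'c conn set \<Rightarrow> 'c calculus \<Rightarrow> ('c form \<Rightarrow> nat) \<Rightarrow> nat \<Rightarrow> 'c sequent \<Rightarrow> bool" where
  "interpolable_within L H w n S \<longleftrightarrow>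
     (\<forall>\<Sigma> \<Lambda>. ante S = \<Sigma> + \<Lambda> \<longrightarrow> (\<exists>C. interpolant L H \<Sigma> \<Lambda> (succ S) C \<and> w C \<le> n))"

definition interpolation_cost ::
  "'c conn set \<Rightarrow> 'c calculus \<Rightarrow> ('c form \<Rightarrow> nat) \<Rightarrow> 'c sequent \<Rightarrow> nat" where
  "interpolation_cost L H w S = (LEAST n. interpolable_within L H w n S)"

lemma interpolation_cost_le: "interpolable_within L H w n S \<Longrightarrow> interpolation_cost L H w S \<le> n"
  unfolding interpolation_cost_def by (rule Least_le)

lemma interpolable_within_mono:
  "interpolable_within L H w m S \<Longrightarrow> m \<le> n \<Longrightarrow> interpolable_within L H w n S"
  unfolding interpolable_within_def using order.trans by blast

definition interpolating_rule ::
  "'c conn set \<Rightarrow> 'c calculus \<Rightarrow> ('c form \<Rightarrow> nat) \<Rightarrow> 'c rule \<Rightarrow> bool" where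
  "interpolating_rule L H w r \<longleftrightarrow>
     (\<forall>Ps S. rule_instance L r Ps S \<longrightarrow> (\<forall>P\<in>#Ps. \<exists>n. interpolable_within L H w n P) \<longrightarrow>
        interpolable_within L H w
          ((\<Sum>P\<in>#Ps. interpolation_cost L H w P + 3) + 2 * size (ante S) + 3) S)"

locale FLe_interpolation = FLe_extension L H + formula_weight w
  for L :: "'c conn set" and H :: "'c calculus" and w :: "'c form \<Rightarrow> nat"
begin

abbreviation cost :: "'c sequent \<Rightarrow> nat" where
  "cost \<equiv> interpolation_cost L H w"

abbreviation interpolable :: "'c sequent \<Rightarrow> bool" where
  "interpolable S \<equiv> \<exists>n. interpolable_within L H w n S"

lemma interpolable_within_cost: "interpolable S \<Longrightarrow> interpolable_within L H w (cost S) S"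
  unfolding interpolation_cost_def by (rule LeastI_ex)

lemma ex_interpolant:
  assumes "interpolable (\<Sigma> + \<Lambda> \<Rightarrow>\<^sub>s \<Delta>)"
  shows "\<exists>C. interpolant L H \<Sigma> \<Lambda> \<Delta> C \<and> w C \<le> cost (\<Sigma> + \<Lambda> \<Rightarrow>\<^sub>s \<Delta>)"
  using interpolable_within_cost[OF assms] by (auto simp: interpolable_within_def)

text \<open>
  Below, a list of pairs \<open>(\<psi>, \<theta>)\<close> stands for the premises \<open>M, \<psi> \<Rightarrow> \<theta>\<close> sharing the context \<open>M\<close>.
\<close>

definition premise_cost ::
  "'c form multiset \<Rightarrow> ('c form multiset \<times> 'c form multiset) list \<Rightarrow> nat" where
  "premise_cost M X = (\<Sum>(\<psi>, \<theta>)\<leftarrow>X. cost (M + \<psi> \<Rightarrow>\<^sub>s \<theta>) + 3)"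

lemma premise_cost_append: "premise_cost M (X @ Y) = premise_cost M X + premise_cost M Y"
  by (simp add: premise_cost_def)

lemma ex_conjunctive_interpolant:
  assumes "langs L A"
    and prems: "\<And>\<psi> \<theta>. (\<psi>, \<theta>) \<in> set X \<Longrightarrow>
      interpolable (A + B + \<psi> \<Rightarrow>\<^sub>s \<theta>) \<and> Vs \<psi> \<union> Vs \<theta> \<subseteq> W"
  obtains C where "A \<turnstile> {#C#}" and "\<And>\<psi> \<theta>. (\<psi>, \<theta>) \<in> set X \<Longrightarrow> add_mset C (B + \<psi>) \<turnstile> \<theta>"
    and "V C \<subseteq> Vs A \<inter> (Vs B \<union> W)" and "w C + 2 * length X \<le> premise_cost (A + B) X + 1"
proof -
  have "\<exists>C. interpolant L H A (B + fst x) (snd x) C \<and> w C \<le> cost (A + B + fst x \<Rightarrow>\<^sub>s snd x)"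
    if "x \<in> set X" for x
    using prems[of "fst x" "snd x"] that unfolding add.assoc by (intro ex_interpolant) auto
  then obtain f where f:
    "\<And>x. x \<in> set X \<Longrightarrow> interpolant L H A (B + fst x) (snd x) (f x)"
    "\<And>x. x \<in> set X \<Longrightarrow> w (f x) \<le> cost (A + B + fst x \<Rightarrow>\<^sub>s snd x)"
    by metis
  let ?C = "big_and (map f X)"
  have in_lang: "\<forall>C\<in>set (map f X). in_lang L C"
    using f(1) by (auto simp: interpolant_def)
  show thesis
  proof
    show "A \<turnstile> {#?C#}"
      using f(1) by (intro prv_big_andR assms(1)) (auto simp: interpolant_iff)
    show "add_mset ?C (B + \<psi>) \<turnstile> \<theta>" if "(\<psi>, \<theta>) \<in> set X" for \<psi> \<theta>
      using f(1)[OF that] that in_lang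
      by (intro prv_big_andL[of "f (\<psi>, \<theta>)"]) (auto simp: interpolant_iff)
    have "V (f x) \<subseteq> Vs A \<inter> (Vs B \<union> W)" if "x \<in> set X" for x
      using f(1)[OF that] prems[of "fst x" "snd x"] that unfolding interpolant_iff by auto
    then show "V ?C \<subseteq> Vs A \<inter> (Vs B \<union> W)" by auto
    have "(\<Sum>x\<leftarrow>X. Suc (w (f x)) + 2) \<le> premise_cost (A + B) X"
      unfolding premise_cost_def using f(2) by (intro sum_list_mono) auto
    moreover have "(\<Sum>x\<leftarrow>X. Suc (w (f x)) + 2) = (\<Sum>C\<leftarrow>map f X. Suc (w C)) + 2 * length X"
      by (induction X) auto
    ultimately show "w ?C + 2 * length X \<le> premise_cost (A + B) X + 1"
      using weight_big(1)[of "map f X"] by linarith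
  qed
qed

lemma ex_disjunctive_interpolant:
  assumes "langs L B" and "in_lang L \<delta>"
    and prems: "\<And>\<phi>. \<phi> \<in> set Y \<Longrightarrow> interpolable (A + B + \<phi> \<Rightarrow>\<^sub>s {#\<delta>#}) \<and> Vs \<phi> \<subseteq> W"
  obtains C where "\<And>\<phi>. \<phi> \<in> set Y \<Longrightarrow> A + \<phi> \<turnstile> {#C#}" and "in_lang L C"
    and "add_mset C B \<turnstile> {#\<delta>#}" and "V C \<subseteq> (Vs A \<union> W) \<inter> (Vs B \<union> V \<delta>)"
    and "w C \<le> premise_cost (A + B) (map (\<lambda>\<phi>. (\<phi>, {#\<delta>#})) Y) + 1"
proof -
  have "\<exists>C. interpolant L H (A + \<phi>) B {#\<delta>#} C \<and> w C \<le> cost (A + B + \<phi> \<Rightarrow>\<^sub>s {#\<delta>#})"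
    if "\<phi> \<in> set Y" for \<phi>
  proof -
    have exchange: "A + B + \<phi> = (A + \<phi>) + B" by (simp add: ac_simps)
    show ?thesis using prems[OF that] unfolding exchange by (intro ex_interpolant) blast
  qed
  then obtain f where f:
    "\<And>\<phi>. \<phi> \<in> set Y \<Longrightarrow> interpolant L H (A + \<phi>) B {#\<delta>#} (f \<phi>)"
    "\<And>\<phi>. \<phi> \<in> set Y \<Longrightarrow> w (f \<phi>) \<le> cost (A + B + \<phi> \<Rightarrow>\<^sub>s {#\<delta>#})"
    by metis
  let ?C = "big_or (map f Y)"
  have in_lang: "\<forall>C\<in>set (map f Y). in_lang L C"
    using f(1) by (auto simp: interpolant_def)
  show thesis
  proof
    show "in_lang L ?C" using in_lang by simp
    show "A + \<phi> \<turnstile> {#?C#}" if "\<phi> \<in> set Y" for \<phi>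
      using f(1)[OF that] that in_lang
      by (intro prv_big_orR[of "f \<phi>"]) (auto simp: interpolant_iff)
    show "add_mset ?C B \<turnstile> {#\<delta>#}"
      using f(1) assms(1,2) by (intro prv_big_orL) (auto simp: interpolant_iff)
    have "V (f \<phi>) \<subseteq> (Vs A \<union> W) \<inter> (Vs B \<union> V \<delta>)" if "\<phi> \<in> set Y" for \<phi>
      using f(1)[OF that] prems[OF that] unfolding interpolant_iff by auto
    then show "V ?C \<subseteq> (Vs A \<union> W) \<inter> (Vs B \<union> V \<delta>)" by auto
    have "(\<Sum>\<phi>\<leftarrow>Y. Suc (w (f \<phi>))) \<le> premise_cost (A + B) (map (\<lambda>\<phi>. (\<phi>, {#\<delta>#})) Y)"
      unfolding premise_cost_def map_map comp_def case_prod_conv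
      using f(2) by (intro sum_list_mono) fastforce
    then show "w ?C \<le> premise_cost (A + B) (map (\<lambda>\<phi>. (\<phi>, {#\<delta>#})) Y) + 1"
      using weight_big(2)[of "map f Y"] by (simp add: comp_def)
  qed
qed

text \<open>
  The interpolant of all premises sharing the context \<open>A + B\<close>, as a multiset with at most one
  element. It is empty for a context with no premises and with \<open>A = {#}\<close>, since the number of such
  contexts is not bounded by the length of the proof.
\<close>

definition context_interpolant ::
  "'c form multiset \<Rightarrow> 'c form multiset \<Rightarrow> ('c form multiset \<times> 'c form multiset) list \<Rightarrow>
   nat set \<Rightarrow> 'c form multiset \<Rightarrow> bool" where
  "context_interpolant A B X W K \<longleftrightarrow>
     (A = {#} \<and> K = {#} \<or> (\<exists>C. A \<turnstile> {#C#} \<and> K = {#C#})) \<and>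
     (\<forall>(\<psi>, \<theta>)\<in>set X. K + B + \<psi> \<turnstile> \<theta>) \<and> Vs K \<subseteq> Vs A \<inter> (Vs B \<union> W) \<and>
     (\<Sum>C\<in>#K. Suc (w C)) \<le> premise_cost (A + B) X + 2 * size A"

lemma ex_context_interpolant:
  assumes "langs L A"
    and prems: "\<And>\<psi> \<theta>. (\<psi>, \<theta>) \<in> set X \<Longrightarrow>
      interpolable (A + B + \<psi> \<Rightarrow>\<^sub>s \<theta>) \<and> Vs \<psi> \<union> Vs \<theta> \<subseteq> W"
  shows "\<exists>K. context_interpolant A B X W K"
proof (cases "X = [] \<and> A = {#}")
  case True
  then show ?thesis by (intro exI[of _ "{#}"]) (simp add: context_interpolant_def)
next
  case False
  then have "1 \<le> length X + size A" by (cases X; cases A) auto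
  moreover obtain C where "A \<turnstile> {#C#}" "\<And>\<psi> \<theta>. (\<psi>, \<theta>) \<in> set X \<Longrightarrow> add_mset C (B + \<psi>) \<turnstile> \<theta>"
    "V C \<subseteq> Vs A \<inter> (Vs B \<union> W)" "w C + 2 * length X \<le> premise_cost (A + B) X + 1"
    using ex_conjunctive_interpolant[OF assms] by metis
  ultimately show ?thesis by (intro exI[of _ "{#C#}"]) (auto simp: context_interpolant_def)
qed

lemma ex_fusion:
  assumes "finite I" and "\<forall>i\<in>I. A i = {#} \<and> K i = {#} \<or> (\<exists>C. A i \<turnstile> {#C#} \<and> K i = {#C#})"
  shows "\<exists>C. (\<Sum>i\<in>I. A i) \<turnstile> {#C#} \<and> (\<forall>\<Gamma> \<Delta>. (\<Sum>i\<in>I. K i) + \<Gamma> \<turnstile> \<Delta> \<longrightarrow> add_mset C \<Gamma> \<turnstile> \<Delta>) \<and>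
    V C = (\<Union>i\<in>I. Vs (K i)) \<and> w C \<le> (\<Sum>i\<in>I. \<Sum>D\<in>#K i. Suc (w D)) + 1"
  using assms
proof (induction rule: finite_induct)
  case empty
  then show ?case using prv_OneR prv_OneL weight_constant(1) by (intro exI[of _ One]) auto
next
  case (insert j I)
  then obtain C where C: "(\<Sum>i\<in>I. A i) \<turnstile> {#C#}"
    "\<And>\<Gamma> \<Delta>. (\<Sum>i\<in>I. K i) + \<Gamma> \<turnstile> \<Delta> \<Longrightarrow> add_mset C \<Gamma> \<turnstile> \<Delta>"
    "V C = (\<Union>i\<in>I. Vs (K i))" "w C \<le> (\<Sum>i\<in>I. \<Sum>D\<in>#K i. Suc (w D)) + 1"
    by auto
  consider (empty) "A j = {#}" "K j = {#}" | (single) D where "A j \<turnstile> {#D#}" "K j = {#D#}"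
    using insert.prems by blast
  then show ?case
  proof cases
    case empty
    then show ?thesis using C insert.hyps by (intro exI[of _ C]) auto
  next
    case (single D)
    have "add_mset (Fus D C) \<Gamma> \<turnstile> \<Delta>" if "(\<Sum>i\<in>insert j I. K i) + \<Gamma> \<turnstile> \<Delta>" for \<Gamma> \<Delta>
      using C(2)[of "add_mset D \<Gamma>" \<Delta>] that single insert.hyps
      by (intro prv_FusL) (simp add: add_mset_commute)
    moreover have "(\<Sum>i\<in>insert j I. A i) \<turnstile> {#Fus D C#}"
      using prv_FusR[OF single(1) C(1)] insert.hyps by simp
    moreover have "w (Fus D C) \<le> (\<Sum>i\<in>insert j I. \<Sum>D\<in>#K i. Suc (w D)) + 1"
      using C(4) weight_binary(3)[of D C] insert.hyps single by simp
    ultimately show ?thesis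
      using C(3) insert.hyps single by (intro exI[of _ "Fus D C"]) auto
  qed
qed

lemma ex_fused_interpolant:
  assumes "finite I" and "\<forall>i\<in>I. langs L (A i)"
    and "\<forall>i\<in>I. \<forall>(\<psi>, \<theta>)\<in>set (X i). interpolable (A i + B i + \<psi> \<Rightarrow>\<^sub>s \<theta>) \<and> Vs \<psi> \<union> Vs \<theta> \<subseteq> W"
  obtains C K where "(\<Sum>i\<in>I. A i) \<turnstile> {#C#}"
    and "\<And>\<Gamma> \<Delta>. (\<Sum>i\<in>I. K i) + \<Gamma> \<turnstile> \<Delta> \<Longrightarrow> add_mset C \<Gamma> \<turnstile> \<Delta>"
    and "\<And>i. i \<in> I \<Longrightarrow> langs L (K i)"
    and "\<And>i \<psi> \<theta>. i \<in> I \<Longrightarrow> (\<psi>, \<theta>) \<in> set (X i) \<Longrightarrow> K i + B i + \<psi> \<turnstile> \<theta>"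
    and "V C \<subseteq> Vs (\<Sum>i\<in>I. A i) \<inter> (Vs (\<Sum>i\<in>I. B i) \<union> W)"
    and "w C \<le> (\<Sum>i\<in>I. premise_cost (A i + B i) (X i) + 2 * size (A i)) + 1"
proof -
  have "\<forall>i\<in>I. \<exists>K. context_interpolant (A i) (B i) (X i) W K"
    using assms(2,3) by (intro ballI ex_context_interpolant) blast+
  from bchoice[OF this] obtain K where
    K: "\<And>i. i \<in> I \<Longrightarrow> context_interpolant (A i) (B i) (X i) W (K i)" by blast
  then have "\<forall>i\<in>I. A i = {#} \<and> K i = {#} \<or> (\<exists>C. A i \<turnstile> {#C#} \<and> K i = {#C#})"
    unfolding context_interpolant_def by blast
  from ex_fusion[OF \<open>finite I\<close> this] obtain C where C: "(\<Sum>i\<in>I. A i) \<turnstile> {#C#}"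
    "\<And>\<Gamma> \<Delta>. (\<Sum>i\<in>I. K i) + \<Gamma> \<turnstile> \<Delta> \<Longrightarrow> add_mset C \<Gamma> \<turnstile> \<Delta>"
    "V C = (\<Union>i\<in>I. Vs (K i))" "w C \<le> (\<Sum>i\<in>I. \<Sum>D\<in>#K i. Suc (w D)) + 1"
    by blast
  show thesis
  proof (rule that[OF C(1,2)])
    show "langs L (K i)" if "i \<in> I" for i
      using K[OF that] prvD(2)[of "A i"] unfolding context_interpolant_def by fastforce
    show "K i + B i + \<psi> \<turnstile> \<theta>" if "i \<in> I" "(\<psi>, \<theta>) \<in> set (X i)" for i \<psi> \<theta>
      using K[OF that(1)] that(2) unfolding context_interpolant_def by blast
    have "Vs (K i) \<subseteq> Vs (A i) \<inter> (Vs (B i) \<union> W)" if "i \<in> I" for i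
      using K[OF that] unfolding context_interpolant_def by blast
    then show "V C \<subseteq> Vs (\<Sum>i\<in>I. A i) \<inter> (Vs (\<Sum>i\<in>I. B i) \<union> W)"
      unfolding C(3) Vs_sum[OF \<open>finite I\<close>] by blast
    have "(\<Sum>i\<in>I. \<Sum>D\<in>#K i. Suc (w D)) \<le> (\<Sum>i\<in>I. premise_cost (A i + B i) (X i) + 2 * size (A i))"
      using K unfolding context_interpolant_def by (intro sum_mono) blast
    then show "w C \<le> (\<Sum>i\<in>I. premise_cost (A i + B i) (X i) + 2 * size (A i)) + 1"
      using C(4) by linarith
  qed
qed

end

section \<open>Semi-analytic rules as blocks of premises\<close>

text \<open>
  The common shape of left, right and context-sharing semi-analytic rules. A block collects the
  premises with the same context \<open>\<Gamma>\<^sub>i\<close>, of which only the main ones carry the succedent \<open>\<Delta>\<^sub>i\<close>;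
  \<open>succ_var\<close> is \<open>None\<close> if there is no \<open>\<Delta>\<^sub>i\<close>.
\<close>

datatype 'f block = Block (ante_var: nat) (succ_var: "nat option")
  (side_prems: "('f multiset \<times> 'f multiset) list") (main_prems: "'f multiset list")

definition block_prems :: "'f multiset \<Rightarrow> 'f block \<Rightarrow> ('f multiset \<times> 'f multiset) list" where
  "block_prems D b = side_prems b @ map (\<lambda>\<phi>. (\<phi>, D)) (main_prems b)"

definition block_vars :: "('a, 'c) fm block \<Rightarrow> 'a set" where
  "block_vars b =
     (\<Union>(\<psi>, \<theta>)\<in>set (side_prems b). Vs \<psi> \<union> Vs \<theta>) \<union> (\<Union>\<phi>\<in>set (main_prems b). Vs \<phi>)"

lemma Vs_block_prems:
  "(\<psi>, \<theta>) \<in> set (block_prems D b) \<Longrightarrow> Vs \<psi> \<union> Vs \<theta> \<subseteq> block_vars b \<union> Vs D"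
  by (auto simp: block_prems_def block_vars_def)

definition block_scheme :: "'c mform block \<Rightarrow> 'c item seq list" where
  "block_scheme b =
     map (\<lambda>(\<psi>, \<theta>). add_mset (Ctx (ante_var b)) (image_mset MF \<psi>) \<Rightarrow>\<^sub>s image_mset MF \<theta>)
       (side_prems b) @
     map (\<lambda>\<phi>. add_mset (Ctx (ante_var b)) (image_mset MF \<phi>) \<Rightarrow>\<^sub>s
       (case succ_var b of None \<Rightarrow> {#} | Some d \<Rightarrow> {#Ctx d#})) (main_prems b)"

definition block_rule ::
  "'c mform block list \<Rightarrow> 'c mform multiset \<Rightarrow> 'c mform multiset \<Rightarrow> 'c rule \<Rightarrow> bool" where
  "block_rule bs \<Phi> \<Theta> r \<longleftrightarrow>
     distinct (map ante_var bs @ List.map_filter succ_var bs) \<and>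
     (\<forall>b\<in>set bs. block_vars b \<subseteq> Vs (\<Phi> + \<Theta>)) \<and>
     prems r = mset (concat (map block_scheme bs)) \<and>
     concl r = (mset (map (Ctx \<circ> ante_var) bs) + image_mset MF \<Phi> \<Rightarrow>\<^sub>s
       mset (map Ctx (List.map_filter succ_var bs)) + image_mset MF \<Theta>)"

lemma mset_concat_map_append:
  "mset (concat (map (\<lambda>x. f x @ g x) xs)) = mset (concat (map f xs)) + mset (concat (map g xs))"
  by (induction xs) auto

lemmas block_rule_simps = block_rule_def block_scheme_def block_vars_def List.map_filter_def
  mset_concat_map_append case_prod_unfold comp_def

lemma left_semi_analytic_block_rule:
  assumes "left_semi_analytic r"
  shows "\<exists>Ps Gs \<phi>. block_rule (map (\<lambda>(\<Pi>, prs). Block \<Pi> None prs []) Ps @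
    map (\<lambda>(\<Gamma>, \<Delta>, \<phi>ss). Block \<Gamma> (Some \<Delta>) [] \<phi>ss) Gs) {#\<phi>#} {#} r"
  using assms unfolding left_semi_analytic_def
  by (elim ex_forward) (simp add: block_rule_simps UN_subset_iff ball_Un)

lemma right_semi_analytic_block_rule:
  assumes "right_semi_analytic r"
  shows "\<exists>Gs \<phi>. block_rule (map (\<lambda>(\<Gamma>, prs). Block \<Gamma> None prs []) Gs) {#} {#\<phi>#} r"
  using assms unfolding right_semi_analytic_def
  by (elim ex_forward) (simp add: block_rule_simps UN_subset_iff)

lemma context_sharing_semi_analytic_block_rule:
  assumes "context_sharing_semi_analytic r"
  shows "\<exists>Gs \<phi>. block_rule (map (\<lambda>(\<Gamma>, \<Delta>, prs, \<phi>ss). Block \<Gamma> (Some \<Delta>) prs \<phi>ss) Gs) {#\<phi>#} {#} r"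
  using assms unfolding context_sharing_semi_analytic_def
  by (elim ex_forward) (simp add: block_rule_simps UN_subset_iff)

abbreviation inst_mset :: "(nat \<Rightarrow> 'c form) \<Rightarrow> 'c mform multiset \<Rightarrow> 'c form multiset" where
  "inst_mset \<sigma> \<equiv> image_mset (inst_form \<sigma>)"

abbreviation inst_block :: "(nat \<Rightarrow> 'c form) \<Rightarrow> 'c mform block \<Rightarrow> 'c form block" where
  "inst_block \<sigma> \<equiv> map_block (inst_form \<sigma>)"

definition inst_ante :: "(nat \<Rightarrow> 'c form multiset) \<Rightarrow> 'c form block \<Rightarrow> 'c form multiset" where
  "inst_ante \<mu> b = \<mu> (ante_var b)"

definition inst_succ :: "(nat \<Rightarrow> 'c form multiset) \<Rightarrow> 'c form block \<Rightarrow> 'c form multiset" where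
  "inst_succ \<mu> b = (case succ_var b of None \<Rightarrow> {#} | Some d \<Rightarrow> \<mu> d)"

lemma block_vars_inst:
  assumes "block_vars b \<subseteq> Vs \<Xi>"
  shows "block_vars (inst_block \<sigma> b) \<subseteq> Vs (inst_mset \<sigma> \<Xi>)"
proof (cases b)
  case (Block c d side main)
  have inst: "Vs (inst_mset \<sigma> M) \<subseteq> Vs (inst_mset \<sigma> \<Xi>)" if "Vs M \<subseteq> block_vars b" for M
    using that assms by (intro Vs_inst_form_mono) blast
  have "Vs \<psi> \<subseteq> block_vars b" "Vs \<theta> \<subseteq> block_vars b" if "(\<psi>, \<theta>) \<in> set side" for \<psi> \<theta>
    using that by (force simp: Block block_vars_def)+
  then have "Vs (inst_mset \<sigma> \<psi>) \<subseteq> Vs (inst_mset \<sigma> \<Xi>)" "Vs (inst_mset \<sigma> \<theta>) \<subseteq> Vs (inst_mset \<sigma> \<Xi>)"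
    if "(\<psi>, \<theta>) \<in> set side" for \<psi> \<theta>
    using that inst by blast+
  moreover have "Vs (inst_mset \<sigma> \<phi>) \<subseteq> Vs (inst_mset \<sigma> \<Xi>)" if "\<phi> \<in> set main" for \<phi>
    using that by (auto simp: Block block_vars_def intro!: inst)
  ultimately show ?thesis by (fastforce simp: Block block_vars_def)
qed

lemma inst_block_scheme:
  "map (inst_seq \<sigma> \<mu>) (block_scheme b) =
   map (\<lambda>(\<psi>, \<theta>). inst_ante \<mu> (inst_block \<sigma> b) + \<psi> \<Rightarrow>\<^sub>s \<theta>)
     (block_prems (inst_succ \<mu> (inst_block \<sigma> b)) (inst_block \<sigma> b))"
  by (cases b) (auto simp: block_scheme_def block_prems_def inst_ante_def inst_succ_def inst_seq_def
      multiset.map_comp comp_def split: option.splits)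

lemma inst_block_rule:
  fixes \<sigma> :: "nat \<Rightarrow> 'c form"
  assumes "block_rule bs \<Phi> \<Theta> r"
  defines "I \<equiv> inst_block \<sigma> ` set bs"
  shows "image_mset (inst_seq \<sigma> \<mu>) (prems r) = (\<Sum>b\<in>I.
      image_mset (\<lambda>(\<psi>, \<theta>). inst_ante \<mu> b + \<psi> \<Rightarrow>\<^sub>s \<theta>) (mset (block_prems (inst_succ \<mu> b) b)))"
    and "inst_seq \<sigma> \<mu> (concl r) = ((\<Sum>b\<in>I. inst_ante \<mu> b) + inst_mset \<sigma> \<Phi> \<Rightarrow>\<^sub>s
      (\<Sum>b\<in>I. inst_succ \<mu> b) + inst_mset \<sigma> \<Theta>)"
proof -
  let ?bs = "map (inst_block \<sigma>) bs"
  have "distinct (map ante_var ?bs)"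
    using assms(1) by (simp add: block_rule_def block.map_sel comp_def)
  then have sum_I: "(\<Sum>b\<in>I. F b) = (\<Sum>b\<leftarrow>?bs. F b)" for F :: "'c form block \<Rightarrow> 'b multiset"
    unfolding I_def distinct_map
    by (metis distinct_map set_map sum_list_distinct_conv_sum_set)
  show "image_mset (inst_seq \<sigma> \<mu>) (prems r) = (\<Sum>b\<in>I.
      image_mset (\<lambda>(\<psi>, \<theta>). inst_ante \<mu> b + \<psi> \<Rightarrow>\<^sub>s \<theta>) (mset (block_prems (inst_succ \<mu> b) b)))"
  proof -
    have "image_mset (inst_seq \<sigma> \<mu>) (prems r) =
        mset (concat (map (\<lambda>b. map (inst_seq \<sigma> \<mu>) (block_scheme b)) bs))"
      using assms(1) by (simp add: block_rule_def map_concat comp_def flip: mset_map)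
    then show ?thesis unfolding sum_I inst_block_scheme by (simp add: mset_concat comp_def)
  qed
  have "(\<Sum>x\<in>#mset (map (Ctx \<circ> ante_var) bs). inst_item \<sigma> \<mu> x) = (\<Sum>b\<in>I. inst_ante \<mu> b)"
    unfolding sum_I by (induction bs) (auto simp: inst_ante_def block.map_sel)
  moreover have "(\<Sum>x\<in>#mset (map Ctx (List.map_filter succ_var bs)). inst_item \<sigma> \<mu> x) =
      (\<Sum>b\<in>I. inst_succ \<mu> b)"
    unfolding sum_I by (induction bs) (auto simp: inst_succ_def block.map_sel split: option.splits)
  ultimately show "inst_seq \<sigma> \<mu> (concl r) = ((\<Sum>b\<in>I. inst_ante \<mu> b) + inst_mset \<sigma> \<Phi> \<Rightarrow>\<^sub>s
      (\<Sum>b\<in>I. inst_succ \<mu> b) + inst_mset \<sigma> \<Theta>)"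
    using assms(1) by (simp add: block_rule_def inst_seq_def multiset.map_comp comp_def)
qed

lemma ex_context_assignment:
  assumes "block_rule bs \<Phi> \<Theta> r"
    and "\<forall>b\<in>set bs. langs L (M (inst_block \<sigma> b)) \<and> langs L (D (inst_block \<sigma> b))"
    and "\<forall>b\<in>set bs. succ_var b = None \<longrightarrow> D (inst_block \<sigma> b) = {#}"
  shows "\<exists>\<mu>. (\<forall>n. langs L (\<mu> n)) \<and>
    (\<forall>b\<in>inst_block \<sigma> ` set bs. inst_ante \<mu> b = M b \<and> inst_succ \<mu> b = D b)"
proof -
  define bindings where "bindings = map (\<lambda>b. (ante_var b, M (inst_block \<sigma> b))) bs @
    map (\<lambda>b. (the (succ_var b), D (inst_block \<sigma> b))) (filter (\<lambda>b. succ_var b \<noteq> None) bs)"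
  define \<mu> where "\<mu> n = (case map_of bindings n of None \<Rightarrow> {#} | Some X \<Rightarrow> X)" for n
  have "distinct (map fst bindings)"
    using assms(1) by (simp add: bindings_def block_rule_def List.map_filter_def comp_def)
  then have \<mu>: "\<mu> n = X" if "(n, X) \<in> set bindings" for n X
    using that by (simp add: \<mu>_def)
  have "langs L (\<mu> n)" for n
  proof (cases "map_of bindings n")
    case (Some X)
    then have "(n, X) \<in> set bindings" by (rule map_of_SomeD)
    then show ?thesis using Some assms(2) by (auto simp: \<mu>_def bindings_def)
  qed (simp add: \<mu>_def)
  moreover have "inst_ante \<mu> (inst_block \<sigma> b) = M (inst_block \<sigma> b)" if "b \<in> set bs" for b
    using that by (auto simp: inst_ante_def block.map_sel bindings_def intro!: \<mu>)
  moreover have "inst_succ \<mu> (inst_block \<sigma> b) = D (inst_block \<sigma> b)" if "b \<in> set bs" for b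
    using that assms(3)
    by (force simp: inst_succ_def block.map_sel bindings_def split: option.splits intro!: \<mu>)
  ultimately show ?thesis by (intro exI[of _ \<mu>]) blast
qed

section \<open>Interpolants for the conclusion of a block rule\<close>

lemma mset_sum_partition:
  fixes M :: "'i \<Rightarrow> 'a multiset"
  assumes "finite I" and "\<Sigma> + \<Lambda> = (\<Sum>i\<in>I. M i)"
  shows "\<exists>A B. (\<forall>i\<in>I. M i = A i + B i) \<and> \<Sigma> = (\<Sum>i\<in>I. A i) \<and> \<Lambda> = (\<Sum>i\<in>I. B i)"
proof -
  have "\<exists>A. (\<forall>i\<in>I. A i \<subseteq># M i) \<and> \<Sigma> = (\<Sum>i\<in>I. A i)" if "\<Sigma> \<subseteq># (\<Sum>i\<in>I. M i)" for \<Sigma>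
    using assms(1) that
  proof (induction arbitrary: \<Sigma> rule: finite_induct)
    case (insert i I)
    then have "\<Sigma> - M i \<subseteq># (\<Sum>i\<in>I. M i)" by (simp add: subset_eq_diff_conv add.commute)
    then obtain A where A: "\<forall>i\<in>I. A i \<subseteq># M i" "\<Sigma> - M i = (\<Sum>i\<in>I. A i)"
      using insert.IH by blast
    have "(\<Sum>j\<in>I. (A(i := \<Sigma> \<inter># M i)) j) = \<Sigma> - M i"
      unfolding A(2) using insert.hyps by (intro sum.cong) auto
    moreover have "\<Sigma> = (\<Sigma> \<inter># M i) + (\<Sigma> - M i)" by (auto simp: multiset_eq_iff)
    ultimately show ?case
      using A(1) insert.hyps by (intro exI[of _ "A(i := \<Sigma> \<inter># M i)"]) auto
  qed simp
  moreover have "\<Sigma> \<subseteq># (\<Sum>i\<in>I. M i)" using assms(2) by (metis mset_subset_eq_add_left)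
  ultimately obtain A where A: "\<forall>i\<in>I. A i \<subseteq># M i" "\<Sigma> = (\<Sum>i\<in>I. A i)" by blast
  have "(\<Sum>i\<in>I. A i) + (\<Sum>i\<in>I. M i - A i) = (\<Sum>i\<in>I. M i)"
    using A(1) by (auto simp flip: sum.distrib intro!: sum.cong)
  then have "\<Lambda> = (\<Sum>i\<in>I. M i - A i)" using assms(2) A(2) by (metis add_left_cancel)
  then show ?thesis using A by (intro exI[of _ A] exI[of _ "\<lambda>i. M i - A i"]) auto
qed

lemma sum_eq_singleE:
  fixes D :: "'i \<Rightarrow> 'a multiset"
  assumes "finite I" and "(\<Sum>i\<in>I. D i) = {#x#}"
  obtains k where "k \<in> I" and "D k = {#x#}" and "\<forall>i\<in>I - {k}. D i = {#}"
proof -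
  have "x \<in># (\<Sum>i\<in>I. D i)" using assms(2) by simp
  then obtain k where k: "k \<in> I" "x \<in># D k"
    using assms(1) by (auto simp: set_mset_sum)
  have "D k + (\<Sum>i\<in>I - {k}. D i) = {#x#}"
    using assms k(1) by (simp add: sum.remove)
  with k(2) have D_k: "D k = {#x#}" and others: "(\<Sum>i\<in>I - {k}. D i) = {#}"
    by (auto simp: union_is_single)
  from others have "(\<Sum>i\<in>I - {k}. size (D i)) = 0"
    by (metis size_empty size_multiset_sum)
  then have "\<forall>i\<in>I - {k}. D i = {#}" using assms(1) by simp
  then show thesis using that k(1) D_k by blast
qed

text \<open>
  From here on the scheme is forgotten: all that is used of the rule is \<open>closed\<close>, that its contexts
  can be replaced independently of each other.
\<close>

locale block_instance = FLe_interpolation L H w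
  for L :: "'c conn set" and H :: "'c calculus" and w :: "'c form \<Rightarrow> nat" +
  fixes I :: "'c form block set" and \<Phi> \<Theta> :: "'c form multiset"
    and M D :: "'c form block \<Rightarrow> 'c form multiset"
  assumes finite_blocks: "finite I"
    and closed: "\<And>N E. \<forall>b\<in>I. langs L (N b) \<and> langs L (E b) \<and> (succ_var b = None \<longrightarrow> E b = {#}) \<Longrightarrow>
      \<forall>b\<in>I. \<forall>(\<psi>, \<theta>)\<in>set (block_prems (E b) b). N b + \<psi> \<turnstile> \<theta> \<Longrightarrow>
      size ((\<Sum>b\<in>I. E b) + \<Theta>) \<le> 1 \<Longrightarrow>
      (\<Sum>b\<in>I. N b) + \<Phi> \<turnstile> (\<Sum>b\<in>I. E b) + \<Theta>"
    and vars: "b \<in> I \<Longrightarrow> block_vars b \<subseteq> Vs (\<Phi> + \<Theta>)"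
    and langs_contexts: "b \<in> I \<Longrightarrow> langs L (M b) \<and> langs L (D b)"
    and no_succedent: "b \<in> I \<Longrightarrow> succ_var b = None \<Longrightarrow> D b = {#}"
    and single_succedent: "size ((\<Sum>b\<in>I. D b) + \<Theta>) \<le> 1"
    and interpolable_prems:
      "b \<in> I \<Longrightarrow> (\<psi>, \<theta>) \<in> set (block_prems (D b) b) \<Longrightarrow> interpolable (M b + \<psi> \<Rightarrow>\<^sub>s \<theta>)"
begin

definition instance_cost :: nat where
  "instance_cost = (\<Sum>b\<in>I. premise_cost (M b) (block_prems (D b) b))"

lemma ex_interpolant_principal_right:
  assumes partition: "\<Sigma> + \<Lambda> = (\<Sum>b\<in>I. M b)"
  shows "\<exists>C. interpolant L H \<Sigma> (\<Lambda> + \<Phi>) ((\<Sum>b\<in>I. D b) + \<Theta>) C \<and>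
    w C \<le> instance_cost + 2 * size \<Sigma> + 1"
proof -
  obtain A B where M: "\<And>b. b \<in> I \<Longrightarrow> M b = A b + B b"
    and \<Sigma>: "\<Sigma> = (\<Sum>b\<in>I. A b)" and \<Lambda>: "\<Lambda> = (\<Sum>b\<in>I. B b)"
    using mset_sum_partition[OF finite_blocks partition] by blast
  have langs: "\<forall>b\<in>I. langs L (A b)" "\<forall>b\<in>I. langs L (B b)"
    using langs_contexts M by auto
  have prems: "\<forall>b\<in>I. \<forall>(\<psi>, \<theta>)\<in>set (block_prems (D b) b). interpolable (A b + B b + \<psi> \<Rightarrow>\<^sub>s \<theta>) \<and>
      Vs \<psi> \<union> Vs \<theta> \<subseteq> Vs (\<Phi> + \<Theta>) \<union> Vs (\<Sum>b\<in>I. D b)"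
  proof clarify
    fix b \<psi> \<theta> assume b: "b \<in> I" and prem: "(\<psi>, \<theta>) \<in> set (block_prems (D b) b)"
    show "interpolable (A b + B b + \<psi> \<Rightarrow>\<^sub>s \<theta>) \<and>
        Vs \<psi> \<union> Vs \<theta> \<subseteq> Vs (\<Phi> + \<Theta>) \<union> Vs (\<Sum>b\<in>I. D b)"
      using interpolable_prems[OF b prem] M[OF b] Vs_block_prems[OF prem] vars[OF b] b
      by (auto simp: Vs_sum[OF finite_blocks])
  qed
  obtain C K where C: "\<Sigma> \<turnstile> {#C#}" "\<And>\<Gamma> \<Delta>. (\<Sum>b\<in>I. K b) + \<Gamma> \<turnstile> \<Delta> \<Longrightarrow> add_mset C \<Gamma> \<turnstile> \<Delta>"
    and K: "\<And>b. b \<in> I \<Longrightarrow> langs L (K b)"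
      "\<And>b \<psi> \<theta>. b \<in> I \<Longrightarrow> (\<psi>, \<theta>) \<in> set (block_prems (D b) b) \<Longrightarrow> K b + B b + \<psi> \<turnstile> \<theta>"
    and V: "V C \<subseteq> Vs \<Sigma> \<inter> (Vs \<Lambda> \<union> (Vs (\<Phi> + \<Theta>) \<union> Vs (\<Sum>b\<in>I. D b)))"
    and weight: "w C \<le> (\<Sum>b\<in>I. premise_cost (A b + B b) (block_prems (D b) b) + 2 * size (A b)) + 1"
    unfolding \<Sigma> \<Lambda>
    by (rule ex_fused_interpolant[OF finite_blocks langs(1) prems]) blast
  have "(\<Sum>b\<in>I. K b + B b) + \<Phi> \<turnstile> (\<Sum>b\<in>I. D b) + \<Theta>"
    using K langs(2) langs_contexts no_succedent single_succedent by (intro closed) auto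
  then have "add_mset C (\<Lambda> + \<Phi>) \<turnstile> (\<Sum>b\<in>I. D b) + \<Theta>"
    unfolding \<Lambda> by (intro C(2)) (simp add: sum.distrib add.assoc)
  then have "interpolant L H \<Sigma> (\<Lambda> + \<Phi>) ((\<Sum>b\<in>I. D b) + \<Theta>) C"
    using C(1) V by (auto simp: interpolant_iff)
  moreover have "w C \<le> instance_cost + 2 * size \<Sigma> + 1"
    using weight M by (simp add: instance_cost_def \<Sigma> sum.distrib sum_distrib_left)
  ultimately show ?thesis by blast
qed

text \<open>If the succedent belongs to the block \<open>k\<close>, these are the premises that do not carry it.\<close>

definition minor_prems ::
  "'c form block \<Rightarrow> 'c form block \<Rightarrow> ('c form multiset \<times> 'c form multiset) list" where
  "minor_prems k b = (if b = k then side_prems k else block_prems (D b) b)"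

lemma instance_cost_minor:
  assumes "k \<in> I"
  shows "instance_cost = premise_cost (M k) (map (\<lambda>\<phi>. (\<phi>, D k)) (main_prems k)) +
    (\<Sum>b\<in>I. premise_cost (M b) (minor_prems k b))"
proof -
  have "(\<Sum>b\<in>I - {k}. premise_cost (M b) (minor_prems k b)) =
      (\<Sum>b\<in>I - {k}. premise_cost (M b) (block_prems (D b) b))"
    by (intro sum.cong) (auto simp: minor_prems_def)
  then show ?thesis
    unfolding instance_cost_def sum.remove[OF finite_blocks assms]
    by (simp add: minor_prems_def block_prems_def premise_cost_append)
qed

context
  fixes k :: "'c form block" and \<delta> :: "'c form"
  assumes left: "\<Theta> = {#}" and k: "k \<in> I"
    and D_k: "D k = {#\<delta>#}" and D_minor: "\<forall>b\<in>I - {k}. D b = {#}"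
begin

lemma minor_prems_interpolable:
  assumes "b \<in> I" and "(\<psi>, \<theta>) \<in> set (minor_prems k b)"
  shows "interpolable (M b + \<psi> \<Rightarrow>\<^sub>s \<theta>) \<and> Vs \<psi> \<union> Vs \<theta> \<subseteq> Vs \<Phi>"
proof -
  have "(\<psi>, \<theta>) \<in> set (block_prems (D b) b)"
    using assms(2) by (auto simp: minor_prems_def block_prems_def split: if_splits)
  moreover have "Vs \<psi> \<union> Vs \<theta> \<subseteq> block_vars b"
    using assms(2) Vs_block_prems[of \<psi> \<theta> "{#}" b] D_minor assms(1)
    by (auto simp: minor_prems_def block_prems_def split: if_splits)
  ultimately show ?thesis
    using interpolable_prems[OF assms(1)] vars[OF assms(1)] left by auto
qed

lemma main_prems_interpolable:
  assumes "\<phi> \<in> set (main_prems k)"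
  shows "interpolable (M k + \<phi> \<Rightarrow>\<^sub>s {#\<delta>#}) \<and> Vs \<phi> \<subseteq> Vs \<Phi>"
proof -
  have "(\<phi>, {#\<delta>#}) \<in> set (block_prems (D k) k)"
    using assms by (simp add: block_prems_def D_k)
  moreover have "Vs \<phi> \<subseteq> block_vars k" using assms by (auto simp: block_vars_def)
  ultimately show ?thesis
    using interpolable_prems[OF k] vars[OF k] left by auto
qed

lemma prv_minor_main:
  assumes "\<forall>b\<in>I. langs L (N b)" and "in_lang L C"
    and minor: "\<And>b \<psi> \<theta>. b \<in> I \<Longrightarrow> (\<psi>, \<theta>) \<in> set (minor_prems k b) \<Longrightarrow> N b + \<psi> \<turnstile> \<theta>"
    and main: "\<And>\<phi>. \<phi> \<in> set (main_prems k) \<Longrightarrow> N k + \<phi> \<turnstile> {#C#}"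
  shows "(\<Sum>b\<in>I. N b) + \<Phi> \<turnstile> {#C#}"
proof -
  define E where "E b = (if b = k then {#C#} else {#})" for b
  have sum_E: "(\<Sum>b\<in>I. E b) = {#C#}" using k finite_blocks by (simp add: E_def)
  have "(\<Sum>b\<in>I. N b) + \<Phi> \<turnstile> (\<Sum>b\<in>I. E b) + \<Theta>"
  proof (rule closed)
    have "succ_var k \<noteq> None" using no_succedent[OF k] D_k by auto
    then show "\<forall>b\<in>I. langs L (N b) \<and> langs L (E b) \<and> (succ_var b = None \<longrightarrow> E b = {#})"
      using assms(1,2) by (simp add: E_def)
    have "set (block_prems (E b) b) \<subseteq>
        set (minor_prems k b) \<union> (if b = k then (\<lambda>\<phi>. (\<phi>, {#C#})) ` set (main_prems k) else {})"
      if "b \<in> I" for b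
      using D_minor that by (auto simp: E_def minor_prems_def block_prems_def)
    then show "\<forall>b\<in>I. \<forall>(\<psi>, \<theta>)\<in>set (block_prems (E b) b). N b + \<psi> \<turnstile> \<theta>"
      using minor main by (fastforce split: if_splits)
  qed (simp add: sum_E left)
  then show ?thesis by (simp add: sum_E left)
qed

lemma ex_minor_interpolant:
  assumes M: "\<forall>b\<in>I. M b = A b + B b" and J: "J \<subseteq> I"
  obtains E K where "(\<Sum>b\<in>J. B b) \<turnstile> {#E#}"
    and "\<And>\<Gamma> \<Delta>. (\<Sum>b\<in>I. K b) + \<Gamma> \<turnstile> \<Delta> \<Longrightarrow> add_mset E \<Gamma> \<turnstile> \<Delta>"
    and "\<And>b. langs L (K b)" and "\<And>b. b \<notin> J \<Longrightarrow> K b = {#}"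
    and "\<And>b \<psi> \<theta>. b \<in> J \<Longrightarrow> (\<psi>, \<theta>) \<in> set (minor_prems k b) \<Longrightarrow> K b + A b + \<psi> \<turnstile> \<theta>"
    and "V E \<subseteq> Vs ((\<Sum>b\<in>I. A b) + \<Phi>) \<inter> Vs (\<Sum>b\<in>I. B b)"
    and "w E \<le> (\<Sum>b\<in>I. premise_cost (M b) (minor_prems k b)) + 2 * size (\<Sum>b\<in>I. B b) + 1"
proof -
  have M': "M b = B b + A b" if "b \<in> I" for b using M that by (simp add: add.commute)
  have "finite J" using J finite_blocks by (rule finite_subset)
  have langs: "\<forall>b\<in>J. langs L (B b)" using langs_contexts M J by auto
  have minor: "\<forall>b\<in>J. \<forall>(\<psi>, \<theta>)\<in>set (minor_prems k b).
      interpolable (B b + A b + \<psi> \<Rightarrow>\<^sub>s \<theta>) \<and> Vs \<psi> \<union> Vs \<theta> \<subseteq> Vs \<Phi>"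
    using minor_prems_interpolable M' J by fastforce
  obtain E K where E: "(\<Sum>b\<in>J. B b) \<turnstile> {#E#}"
      "\<And>\<Gamma> \<Delta>. (\<Sum>b\<in>J. K b) + \<Gamma> \<turnstile> \<Delta> \<Longrightarrow> add_mset E \<Gamma> \<turnstile> \<Delta>"
    and K: "\<And>b. b \<in> J \<Longrightarrow> langs L (K b)"
      "\<And>b \<psi> \<theta>. b \<in> J \<Longrightarrow> (\<psi>, \<theta>) \<in> set (minor_prems k b) \<Longrightarrow> K b + A b + \<psi> \<turnstile> \<theta>"
    and V: "V E \<subseteq> Vs (\<Sum>b\<in>J. B b) \<inter> (Vs (\<Sum>b\<in>J. A b) \<union> Vs \<Phi>)"
    and weight: "w E \<le> (\<Sum>b\<in>J. premise_cost (B b + A b) (minor_prems k b) + 2 * size (B b)) + 1"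
    by (rule ex_fused_interpolant[OF \<open>finite J\<close> langs minor]) blast
  show thesis
  proof
    show "add_mset E \<Gamma> \<turnstile> \<Delta>" if "(\<Sum>b\<in>I. if b \<in> J then K b else {#}) + \<Gamma> \<turnstile> \<Delta>" for \<Gamma> \<Delta>
      using E(2) that J finite_blocks by (simp add: sum.inter_restrict[symmetric] Int_absorb1)
    show "V E \<subseteq> Vs ((\<Sum>b\<in>I. A b) + \<Phi>) \<inter> Vs (\<Sum>b\<in>I. B b)"
      using V J unfolding Vs_union Vs_sum[OF finite_blocks] Vs_sum[OF \<open>finite J\<close>] by blast
    have "(\<Sum>b\<in>J. premise_cost (B b + A b) (minor_prems k b) + 2 * size (B b)) \<le>
        (\<Sum>b\<in>I. premise_cost (M b) (minor_prems k b) + 2 * size (B b))"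
      using M' J finite_blocks by (intro order.trans[OF eq_refl sum_mono2] sum.cong) auto
    then show "w E \<le> (\<Sum>b\<in>I. premise_cost (M b) (minor_prems k b)) + 2 * size (\<Sum>b\<in>I. B b) + 1"
      using weight by (simp add: sum.distrib sum_distrib_left)
  qed (use E(1) K in simp_all)
qed

text \<open>
  The contexts indexed by \<open>J\<close> are those whose minor premises are interpolated by \<open>E\<close>: all but \<open>k\<close>
  for a left rule, where \<open>B k\<close> must be saved for the right premise of \<open>L\<rightarrow>\<close>, and all of them for a
  context-sharing rule.
\<close>

lemma ex_implicative_interpolant:
  assumes M: "\<forall>b\<in>I. M b = A b + B b" and J: "J \<subseteq> I" "I - {k} \<subseteq> J"
    and side: "k \<notin> J \<Longrightarrow> side_prems k = []"
    and weakening: "k \<in> J \<Longrightarrow> admissible L H left_weakening"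
  obtains E C where "add_mset E ((\<Sum>b\<in>I. A b) + \<Phi>) \<turnstile> {#C#}" and "(\<Sum>b\<in>J. B b) \<turnstile> {#E#}"
    and "add_mset C (B k) \<turnstile> {#\<delta>#}"
    and "V E \<union> V C \<subseteq> Vs ((\<Sum>b\<in>I. A b) + \<Phi>) \<inter> (Vs (\<Sum>b\<in>I. B b) \<union> V \<delta>)"
    and "w E + w C \<le> instance_cost + 2 * size (\<Sum>b\<in>I. B b) + 2"
proof -
  have langs: "\<forall>b\<in>I. langs L (A b)" "langs L (B k)" "in_lang L \<delta>"
    using langs_contexts M k D_k by fastforce+
  obtain C where C: "\<And>\<phi>. \<phi> \<in> set (main_prems k) \<Longrightarrow> A k + \<phi> \<turnstile> {#C#}" "in_lang L C"
      "add_mset C (B k) \<turnstile> {#\<delta>#}" "V C \<subseteq> (Vs (A k) \<union> Vs \<Phi>) \<inter> (Vs (B k) \<union> V \<delta>)"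
    and weight_C: "w C \<le> premise_cost (M k) (map (\<lambda>\<phi>. (\<phi>, D k)) (main_prems k)) + 1"
    using ex_disjunctive_interpolant[OF langs(2,3), of "main_prems k" "A k" "Vs \<Phi>"]
      main_prems_interpolable bspec[OF M k] D_k by metis
  obtain E K where E: "(\<Sum>b\<in>J. B b) \<turnstile> {#E#}"
      "\<And>\<Gamma> \<Delta>. (\<Sum>b\<in>I. K b) + \<Gamma> \<turnstile> \<Delta> \<Longrightarrow> add_mset E \<Gamma> \<turnstile> \<Delta>"
    and K: "\<And>b. langs L (K b)" "\<And>b. b \<notin> J \<Longrightarrow> K b = {#}"
      "\<And>b \<psi> \<theta>. b \<in> J \<Longrightarrow> (\<psi>, \<theta>) \<in> set (minor_prems k b) \<Longrightarrow> K b + A b + \<psi> \<turnstile> \<theta>"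
    and V_E: "V E \<subseteq> Vs ((\<Sum>b\<in>I. A b) + \<Phi>) \<inter> Vs (\<Sum>b\<in>I. B b)"
    and weight_E:
      "w E \<le> (\<Sum>b\<in>I. premise_cost (M b) (minor_prems k b)) + 2 * size (\<Sum>b\<in>I. B b) + 1"
    by (rule ex_minor_interpolant[OF M J(1)]) blast
  show thesis
  proof
    have "K b + A b + \<psi> \<turnstile> \<theta>" if "b \<in> I" "(\<psi>, \<theta>) \<in> set (minor_prems k b)" for b \<psi> \<theta>
      using that K(3) J(2) side by (cases "b \<in> J") (auto simp: minor_prems_def)
    moreover have "K k + A k + \<phi> \<turnstile> {#C#}" if "\<phi> \<in> set (main_prems k)" for \<phi>
      using prv_weaken[OF weakening C(1)[OF that] K(1)] C(1)[OF that] K(2)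
      by (cases "k \<in> J") (simp_all add: ac_simps)
    ultimately have "(\<Sum>b\<in>I. K b + A b) + \<Phi> \<turnstile> {#C#}"
      using langs(1) K(1) C(2) by (intro prv_minor_main) auto
    then show "add_mset E ((\<Sum>b\<in>I. A b) + \<Phi>) \<turnstile> {#C#}"
      by (intro E(2)) (simp add: sum.distrib add.assoc)
    show "V E \<union> V C \<subseteq> Vs ((\<Sum>b\<in>I. A b) + \<Phi>) \<inter> (Vs (\<Sum>b\<in>I. B b) \<union> V \<delta>)"
      using V_E C(4) k unfolding Vs_union Vs_sum[OF finite_blocks] by blast
    show "w E + w C \<le> instance_cost + 2 * size (\<Sum>b\<in>I. B b) + 2"
      using weight_E weight_C unfolding instance_cost_minor[OF k] by linarith
  qed (fact E(1), fact C(3))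
qed

lemma ex_interpolant_principal_left_succedent:
  assumes partition: "\<Sigma> + \<Lambda> = (\<Sum>b\<in>I. M b)"
    and sharing: "side_prems k = [] \<or>
      admissible L H left_weakening \<and> admissible L H context_sharing_left_imp"
  shows "\<exists>C. interpolant L H (\<Sigma> + \<Phi>) \<Lambda> {#\<delta>#} C \<and> w C \<le> instance_cost + 2 * size \<Lambda> + 3"
proof -
  obtain A B where M: "\<forall>b\<in>I. M b = A b + B b"
    and \<Sigma>: "\<Sigma> = (\<Sum>b\<in>I. A b)" and \<Lambda>: "\<Lambda> = (\<Sum>b\<in>I. B b)"
    using mset_sum_partition[OF finite_blocks partition] by blast
  have interpolant: "\<exists>C. interpolant L H (\<Sigma> + \<Phi>) \<Lambda> {#\<delta>#} C \<and> w C \<le> instance_cost + 2 * size \<Lambda> + 3"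
    if "add_mset E (\<Sigma> + \<Phi>) \<turnstile> {#C#}" "add_mset (Imp E C) \<Lambda> \<turnstile> {#\<delta>#}"
      "V E \<union> V C \<subseteq> Vs (\<Sigma> + \<Phi>) \<inter> (Vs \<Lambda> \<union> V \<delta>)" "w E + w C \<le> instance_cost + 2 * size \<Lambda> + 2"
    for E C
    using that weight_binary(4)[of E C]
    by (intro exI[of _ "Imp E C"]) (auto simp: interpolant_iff intro: prv_ImpR)
  have \<Lambda>_k: "\<Lambda> = (\<Sum>b\<in>I - {k}. B b) + B k"
    using k finite_blocks by (simp add: \<Lambda> sum.remove add.commute)
  from sharing show ?thesis
  proof
    assume no_side: "side_prems k = []"
    obtain E C where "add_mset E (\<Sigma> + \<Phi>) \<turnstile> {#C#}" "(\<Sum>b\<in>I - {k}. B b) \<turnstile> {#E#}"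
      "add_mset C (B k) \<turnstile> {#\<delta>#}" "V E \<union> V C \<subseteq> Vs (\<Sigma> + \<Phi>) \<inter> (Vs \<Lambda> \<union> V \<delta>)"
      "w E + w C \<le> instance_cost + 2 * size \<Lambda> + 2"
      unfolding \<Sigma> \<Lambda> by (rule ex_implicative_interpolant[OF M, of "I - {k}"]) (use no_side in blast)+
    then show ?thesis using interpolant prv_ImpL unfolding \<Lambda>_k by blast
  next
    assume adm: "admissible L H left_weakening \<and> admissible L H context_sharing_left_imp"
    obtain E C where E: "add_mset E (\<Sigma> + \<Phi>) \<turnstile> {#C#}" "\<Lambda> \<turnstile> {#E#}"
      and C: "add_mset C (B k) \<turnstile> {#\<delta>#}" and "V E \<union> V C \<subseteq> Vs (\<Sigma> + \<Phi>) \<inter> (Vs \<Lambda> \<union> V \<delta>)"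
      "w E + w C \<le> instance_cost + 2 * size \<Lambda> + 2"
      unfolding \<Sigma> \<Lambda> by (rule ex_implicative_interpolant[OF M, of I]) (use adm k in blast)+
    moreover have "add_mset C \<Lambda> \<turnstile> {#\<delta>#}"
      using prv_weaken[OF conjunct1[OF adm] C, of "\<Sum>b\<in>I - {k}. B b"] prvD(1)[OF E(2)]
      by (simp add: \<Lambda>_k add.commute)
    ultimately show ?thesis using interpolant prv_ImpL_shared[OF conjunct2[OF adm] E(2)] by blast
  qed
qed

end

lemma ex_interpolant_principal_left:
  assumes left: "\<Theta> = {#}" and partition: "\<Sigma> + \<Lambda> = (\<Sum>b\<in>I. M b)"
    and sharing: "(\<forall>b\<in>I. side_prems b = [] \<or> succ_var b = None) \<or>
      admissible L H left_weakening \<and> admissible L H context_sharing_left_imp"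
  shows "\<exists>C. interpolant L H (\<Sigma> + \<Phi>) \<Lambda> (\<Sum>b\<in>I. D b) C \<and> w C \<le> instance_cost + 2 * size \<Lambda> + 3"
proof (cases "(\<Sum>b\<in>I. D b) = {#}")
  case True
  have "\<Lambda> + \<Sigma> = (\<Sum>b\<in>I. M b)" using partition by (simp add: add.commute)
  from ex_interpolant_principal_right[OF this] obtain C where
    "interpolant L H \<Lambda> (\<Sigma> + \<Phi>) {#} C" "w C \<le> instance_cost + 2 * size \<Lambda> + 1"
    using left True by auto
  moreover have "w (Imp C Zero) \<le> w C + 2"
    using weight_binary(4)[of C Zero] weight_constant(2) by simp
  ultimately show ?thesis
    using True by (intro exI[of _ "Imp C Zero"]) (simp add: interpolant_swap)
next
  case False
  then have "size (\<Sum>b\<in>I. D b) = 1"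
    using single_succedent left by (simp add: le_Suc_eq del: size_multiset_sum)
  then obtain \<delta> where \<delta>: "(\<Sum>b\<in>I. D b) = {#\<delta>#}" using size_1_singleton_mset by blast
  then obtain k where k: "k \<in> I" "D k = {#\<delta>#}" "\<forall>b\<in>I - {k}. D b = {#}"
    using sum_eq_singleE[OF finite_blocks] by metis
  then have "side_prems k = [] \<or>
      admissible L H left_weakening \<and> admissible L H context_sharing_left_imp"
    using sharing no_succedent[of k] by auto
  from ex_interpolant_principal_left_succedent[OF left k partition this] show ?thesis
    by (simp only: \<delta>)
qed

lemma interpolable_conclusion:
  assumes principal: "\<Phi> = {#} \<or> (\<exists>\<phi>. \<Phi> = {#\<phi>#}) \<and> \<Theta> = {#}"
    and sharing: "(\<forall>b\<in>I. side_prems b = [] \<or> succ_var b = None) \<or>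
      admissible L H left_weakening \<and> admissible L H context_sharing_left_imp"
  shows "interpolable_within L H w (instance_cost + 2 * size (\<Sum>b\<in>I. M b) + 3)
    ((\<Sum>b\<in>I. M b) + \<Phi> \<Rightarrow>\<^sub>s (\<Sum>b\<in>I. D b) + \<Theta>)"
  unfolding interpolable_within_def seq.sel
proof (intro allI impI)
  fix \<Sigma> \<Lambda> assume conclusion: "(\<Sum>b\<in>I. M b) + \<Phi> = \<Sigma> + \<Lambda>"
  let ?bound = "instance_cost + 2 * size (\<Sum>b\<in>I. M b) + 3"
  have "\<Phi> \<subseteq># \<Lambda> \<or> \<Phi> \<subseteq># \<Sigma> \<and> \<Theta> = {#}"
  proof (cases "\<Phi> = {#}")
    case False
    then obtain \<phi> where \<phi>: "\<Phi> = {#\<phi>#}" "\<Theta> = {#}" using principal by blast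
    then have "\<phi> \<in># \<Sigma> + \<Lambda>" by (simp flip: conclusion)
    then show ?thesis using \<phi> by auto
  qed simp
  then consider (right) \<Lambda>' where "\<Lambda> = \<Lambda>' + \<Phi>" | (left) \<Sigma>' where "\<Sigma> = \<Sigma>' + \<Phi>" "\<Theta> = {#}"
    by (metis subset_mset.diff_add)
  then show "\<exists>C. interpolant L H \<Sigma> \<Lambda> ((\<Sum>b\<in>I. D b) + \<Theta>) C \<and> w C \<le> ?bound"
  proof cases
    case right
    then have partition: "\<Sigma> + \<Lambda>' = (\<Sum>b\<in>I. M b)" using conclusion by (simp add: add.assoc[symmetric])
    then have "size \<Sigma> \<le> size (\<Sum>b\<in>I. M b)" by (metis le_add1 size_union)
    then show ?thesis using ex_interpolant_principal_right[OF partition] right by fastforce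
  next
    case left
    then have partition: "\<Sigma>' + \<Lambda> = (\<Sum>b\<in>I. M b)" using conclusion by (simp add: ac_simps)
    then have "size \<Lambda> \<le> size (\<Sum>b\<in>I. M b)" by (metis le_add2 size_union)
    then show ?thesis
      using ex_interpolant_principal_left[OF left(2) partition sharing] left by fastforce
  qed
qed

end

lemma sum_mset_sum:
  fixes F :: "'i \<Rightarrow> 'a multiset" and f :: "'a \<Rightarrow> nat"
  assumes "finite I"
  shows "(\<Sum>x\<in>#(\<Sum>i\<in>I. F i). f x) = (\<Sum>i\<in>I. \<Sum>x\<in>#F i. f x)"
  using assms by (induction rule: finite_induct) auto

context FLe_interpolation
begin

lemma prv_block_rule:
  assumes "admissible L H r" and "block_rule bs \<Phi> \<Theta> r" and "\<forall>n. in_lang L (\<sigma> n)"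
  defines "I \<equiv> inst_block \<sigma> ` set bs"
  assumes contexts: "\<forall>b\<in>I. langs L (N b) \<and> langs L (E b) \<and> (succ_var b = None \<longrightarrow> E b = {#})"
    and prems: "\<forall>b\<in>I. \<forall>(\<psi>, \<theta>)\<in>set (block_prems (E b) b). N b + \<psi> \<turnstile> \<theta>"
    and "size ((\<Sum>b\<in>I. E b) + inst_mset \<sigma> \<Theta>) \<le> 1"
  shows "(\<Sum>b\<in>I. N b) + inst_mset \<sigma> \<Phi> \<turnstile> (\<Sum>b\<in>I. E b) + inst_mset \<sigma> \<Theta>"
proof -
  obtain \<mu> where \<mu>: "\<forall>n. langs L (\<mu> n)" "\<forall>b\<in>I. inst_ante \<mu> b = N b \<and> inst_succ \<mu> b = E b"
    using ex_context_assignment[OF assms(2), where L = L and M = N and D = E and \<sigma> = \<sigma>] contexts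
    by (auto simp: I_def block.map_sel)
  note inst = inst_block_rule[OF assms(2), of \<sigma> \<mu>, folded I_def]
  have "finite I" by (simp add: I_def)
  have "provable L H (inst_seq \<sigma> \<mu> (concl r))"
  proof (rule admissibleD[OF assms(1,3) \<mu>(1) lang_H])
    have "\<forall>P\<in>#image_mset (inst_seq \<sigma> \<mu>) (prems r). provable L H P"
      unfolding inst(1) set_mset_sum[OF \<open>finite I\<close>] using prems \<mu>(2) by fastforce
    then show "\<forall>P\<in>#prems r. provable L H (inst_seq \<sigma> \<mu> P)" by simp
    show "single_conclusion (inst_seq \<sigma> \<mu> (concl r))"
      using assms(7) \<mu>(2) by (simp add: inst(2) single_conclusion_def)
  qed
  then show ?thesis using \<mu>(2) by (simp add: inst(2))
qed

lemma interpolating_rule_block_rule: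
  assumes adm: "admissible L H r" and r: "block_rule bs \<Phi> \<Theta> r"
    and principal: "\<Phi> = {#} \<or> (\<exists>\<phi>. \<Phi> = {#\<phi>#}) \<and> \<Theta> = {#}"
    and sharing: "(\<forall>b\<in>set bs. side_prems b = [] \<or> succ_var b = None) \<or>
      admissible L H left_weakening \<and> admissible L H context_sharing_left_imp"
  shows "interpolating_rule L H w r"
  unfolding interpolating_rule_def
proof (intro allI impI)
  fix Ps S assume "rule_instance L r Ps S" and interpolable: "\<forall>P\<in>#Ps. interpolable P"
  then obtain \<sigma> \<mu> where \<sigma>: "\<forall>n. in_lang L (\<sigma> n)" and \<mu>: "\<forall>n. langs L (\<mu> n)"
    and Ps: "Ps = image_mset (inst_seq \<sigma> \<mu>) (prems r)" and S: "S = inst_seq \<sigma> \<mu> (concl r)"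
    and single: "single_conclusion S"
    by (auto simp: rule_instance_def)
  define I where "I = inst_block \<sigma> ` set bs"
  have "finite I" by (simp add: I_def)
  note inst = inst_block_rule[OF r, of \<sigma> \<mu>, folded I_def]
  interpret block_instance L H w I "inst_mset \<sigma> \<Phi>" "inst_mset \<sigma> \<Theta>" "inst_ante \<mu>" "inst_succ \<mu>"
  proof unfold_locales
    show "(\<Sum>b\<in>I. N b) + inst_mset \<sigma> \<Phi> \<turnstile> (\<Sum>b\<in>I. E b) + inst_mset \<sigma> \<Theta>"
      if "\<forall>b\<in>I. langs L (N b) \<and> langs L (E b) \<and> (succ_var b = None \<longrightarrow> E b = {#})"
        "\<forall>b\<in>I. \<forall>(\<psi>, \<theta>)\<in>set (block_prems (E b) b). N b + \<psi> \<turnstile> \<theta>"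
        "size ((\<Sum>b\<in>I. E b) + inst_mset \<sigma> \<Theta>) \<le> 1" for N E
      using prv_block_rule[OF adm r \<sigma>] that unfolding I_def by blast
    show "block_vars b \<subseteq> Vs (inst_mset \<sigma> \<Phi> + inst_mset \<sigma> \<Theta>)" if "b \<in> I" for b
      using that r block_vars_inst[of _ "\<Phi> + \<Theta>" \<sigma>] by (auto simp: I_def block_rule_def)
    show "interpolable (inst_ante \<mu> b + \<psi> \<Rightarrow>\<^sub>s \<theta>)"
      if "b \<in> I" "(\<psi>, \<theta>) \<in> set (block_prems (inst_succ \<mu> b) b)" for b \<psi> \<theta>
      using interpolable that unfolding Ps inst(1) set_mset_sum[OF \<open>finite I\<close>] by fastforce
  qed (use \<mu> single in \<open>auto simp: I_def inst_ante_def inst_succ_def S inst(2) single_conclusion_def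
    split: option.splits\<close>)
  have "(\<Sum>P\<in>#Ps. cost P + 3) = instance_cost"
    unfolding Ps inst(1) sum_mset_sum[OF \<open>finite I\<close>] instance_cost_def premise_cost_def
    by (simp add: multiset.map_comp comp_def case_prod_unfold flip: sum_mset_sum_list mset_map)
  moreover have "interpolable_within L H w (instance_cost + 2 * size (\<Sum>b\<in>I. inst_ante \<mu> b) + 3) S"
    unfolding S inst(2) using principal sharing
    by (intro interpolable_conclusion) (auto simp: I_def block.map_sel)
  ultimately show "interpolable_within L H w ((\<Sum>P\<in>#Ps. cost P + 3) + 2 * size (ante S) + 3) S"
    by (auto simp: S inst(2) simp del: size_multiset_sum elim: interpolable_within_mono)
qed

end

section \<open>Modal rules\<close>

definition boxing_rule :: "'c item multiset \<Rightarrow> nat \<Rightarrow> 'c mform multiset \<Rightarrow> 'c rule" where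
  "boxing_rule P \<Gamma> \<Theta> = Rule {#P \<Rightarrow>\<^sub>s image_mset MF \<Theta>#}
     ({#BoxCtx \<Gamma>#} \<Rightarrow>\<^sub>s image_mset MF (image_mset Box \<Theta>))"

lemma rule_K_iff: "rule_K r \<longleftrightarrow> (\<exists>\<Gamma> n. r = boxing_rule {#Ctx \<Gamma>#} \<Gamma> {#Var (MForm n)#})"
  by (simp add: rule_K_def boxing_rule_def)

lemma rule_D_iff: "rule_D r \<longleftrightarrow> (\<exists>\<Gamma>. r = boxing_rule {#Ctx \<Gamma>#} \<Gamma> {#})"
  by (simp add: rule_D_def boxing_rule_def)

lemma rule_RS4_iff: "rule_RS4 r \<longleftrightarrow> (\<exists>\<Gamma> n. r = boxing_rule {#BoxCtx \<Gamma>#} \<Gamma> {#Var (MForm n)#})"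
  by (simp add: rule_RS4_def boxing_rule_def)

lemma rule_4_iff: "rule_4 r \<longleftrightarrow> (\<exists>\<Gamma> n. r = boxing_rule {#BoxCtx \<Gamma>, Ctx \<Gamma>#} \<Gamma> {#Var (MForm n)#})"
  by (simp add: rule_4_def boxing_rule_def)

lemma rule_4D_iff: "rule_4D r \<longleftrightarrow> (\<exists>\<Gamma>. r = boxing_rule {#BoxCtx \<Gamma>, Ctx \<Gamma>#} \<Gamma> {#})"
  by (simp add: rule_4D_def boxing_rule_def)

definition denotes_context ::
  "'c item multiset \<Rightarrow> nat \<Rightarrow> ('c form multiset \<Rightarrow> 'c form multiset) \<Rightarrow> bool" where
  "denotes_context P \<Gamma> F \<longleftrightarrow> (\<forall>\<sigma> \<mu>. (\<Sum>x\<in>#P. inst_item \<sigma> \<mu> x) = F (\<mu> \<Gamma>))"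

lemma denotes_context_items:
  "denotes_context {#Ctx \<Gamma>#} \<Gamma> (\<lambda>N. N)"
  "denotes_context {#BoxCtx \<Gamma>#} \<Gamma> (image_mset Box)"
  "denotes_context {#BoxCtx \<Gamma>, Ctx \<Gamma>#} \<Gamma> (\<lambda>N. image_mset Box N + N)"
  by (simp_all add: denotes_context_def)

lemma inst_boxing_rule:
  assumes "denotes_context P \<Gamma> F"
  shows "image_mset (inst_seq \<sigma> \<mu>) (prems (boxing_rule P \<Gamma> \<Theta>)) = {#F (\<mu> \<Gamma>) \<Rightarrow>\<^sub>s inst_mset \<sigma> \<Theta>#}"
    and "inst_seq \<sigma> \<mu> (concl (boxing_rule P \<Gamma> \<Theta>)) =
      (image_mset Box (\<mu> \<Gamma>) \<Rightarrow>\<^sub>s image_mset Box (inst_mset \<sigma> \<Theta>))"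
  using assms
  by (simp_all add: boxing_rule_def denotes_context_def inst_seq_def multiset.map_comp comp_def)

context FLe_interpolation
begin

lemma prv_boxing_rule:
  assumes "admissible L H (boxing_rule P \<Gamma> \<Theta>)" and F: "denotes_context P \<Gamma> F"
    and "\<forall>n. in_lang L (\<sigma> n)" and "langs L N" and "F N \<turnstile> inst_mset \<sigma> \<Theta>"
  shows "image_mset Box N \<turnstile> image_mset Box (inst_mset \<sigma> \<Theta>)"
proof -
  have "\<forall>P\<in>#image_mset (inst_seq \<sigma> (\<lambda>_. N)) (prems (boxing_rule P \<Gamma> \<Theta>)). provable L H P"
    using assms(5) unfolding inst_boxing_rule[OF F] by simp
  then have "provable L H (inst_seq \<sigma> (\<lambda>_. N) (concl (boxing_rule P \<Gamma> \<Theta>)))"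
    using assms(4) prvD(3)[OF assms(5)]
    by (intro admissibleD[OF assms(1,3) _ lang_H])
      (auto simp: inst_boxing_rule(2)[OF F] single_conclusion_def)
  then show ?thesis by (simp add: inst_boxing_rule(2)[OF F])
qed

text \<open>
  \<open>F \<Gamma>\<close> is the context \<open>\<Gamma>\<close>, \<open>\<box>\<Gamma>\<close> or \<open>\<box>\<Gamma>, \<Gamma>\<close> of the premise. The last two conditions make \<open>\<box>C\<close>
  an interpolant of the conclusion whenever \<open>C\<close> is one of the premise.
\<close>

definition boxable :: "('c form multiset \<Rightarrow> 'c form multiset) \<Rightarrow> bool" where
  "boxable F \<longleftrightarrow> (\<forall>M N. F (M + N) = F M + F N) \<and> (\<forall>N. Vs (F N) = Vs N) \<and>
     (\<forall>N. langs L (F N) \<longrightarrow> langs L N) \<and>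
     (\<forall>N \<phi>. F N \<turnstile> {#\<phi>#} \<longrightarrow> image_mset Box N \<turnstile> {#Box \<phi>#}) \<and>
     (\<forall>N \<phi> \<Delta>. add_mset \<phi> (F N) \<turnstile> \<Delta> \<longrightarrow> F (add_mset \<phi> N) \<turnstile> \<Delta>)"

lemma prv_necessitation:
  assumes "admissible L H (boxing_rule P \<Gamma> {#Var (MForm n)#})" and "denotes_context P \<Gamma> F"
    and "langs L N" and "F N \<turnstile> {#\<phi>#}"
  shows "image_mset Box N \<turnstile> {#Box \<phi>#}"
  using prv_boxing_rule[OF assms(1,2), of "\<lambda>_. \<phi>" N] assms(3,4) prvD(2)[OF assms(4)] by simp

lemma boxable_K:
  assumes "admissible L H r" and "rule_K r"
  shows "boxable (\<lambda>N. N)"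
  using assms unfolding rule_K_iff boxable_def
  by (auto intro: prv_necessitation[OF _ denotes_context_items(1)] dest: prvD(1))

lemma prv_LS4:
  assumes "admissible L H r" "rule_LS4 r" and "add_mset \<phi> \<Gamma> \<turnstile> \<Delta>"
  shows "add_mset (Box \<phi>) \<Gamma> \<turnstile> \<Delta>"
proof -
  obtain c d n where r: "c \<noteq> d" "r = Rule {#{#Ctx c, MF (Var (MForm n))#} \<Rightarrow>\<^sub>s {#Ctx d#}#}
       ({#Ctx c, MF (Box (Var (MForm n)))#} \<Rightarrow>\<^sub>s {#Ctx d#})"
    using assms(2) by (auto simp: rule_LS4_def)
  show ?thesis
    using assms(3) r(1) prvD[OF assms(3)]
      admissibleD[OF assms(1), of "\<lambda>_. \<phi>" "\<lambda>m. if m = c then \<Gamma> else \<Delta>"] lang_H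
    by (simp add: r(2) inst_simps)
qed

lemma boxable_S4:
  assumes "admissible L H r" "rule_RS4 r" and "admissible L H l" "rule_LS4 l"
  shows "boxable (image_mset Box)"
proof -
  have "image_mset Box N \<turnstile> {#Box \<phi>#}" if "image_mset Box N \<turnstile> {#\<phi>#}" for N \<phi>
    using assms(1,2) prvD(1)[OF that] that unfolding rule_RS4_iff
    by (auto intro: prv_necessitation[OF _ denotes_context_items(2)])
  then show ?thesis unfolding boxable_def by (auto intro: prv_LS4[OF assms(3,4)])
qed

lemma boxable_4:
  assumes "admissible L H r" "rule_4 r" and "admissible L H left_weakening_boxed"
  shows "boxable (\<lambda>N. image_mset Box N + N)"
proof -
  have "add_mset (Box \<phi>) (add_mset \<phi> (image_mset Box N + N)) \<turnstile> \<Delta>"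
    if "add_mset \<phi> (image_mset Box N + N) \<turnstile> \<Delta>" for \<phi> N \<Delta>
    using prv_weaken_Box[OF assms(3) that, of \<phi>] prvD(1)[OF that] by simp
  moreover have "image_mset Box N \<turnstile> {#Box \<phi>#}" if "image_mset Box N + N \<turnstile> {#\<phi>#}" for N \<phi>
    using assms(1,2) prvD(1)[OF that] that unfolding rule_4_iff
    by (auto intro: prv_necessitation[OF _ denotes_context_items(3)])
  ultimately show ?thesis
    unfolding boxable_def by (auto simp: ac_simps add_mset_commute)
qed

lemma interpolable_within_Box:
  assumes F: "boxable F" and interpolable: "interpolable (F N \<Rightarrow>\<^sub>s \<theta>)"
    and closed: "\<And>B. langs L B \<Longrightarrow> F B \<turnstile> \<theta> \<Longrightarrow> image_mset Box B \<turnstile> image_mset Box \<theta>"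
  shows "interpolable_within L H w (cost (F N \<Rightarrow>\<^sub>s \<theta>) + 1) (image_mset Box N \<Rightarrow>\<^sub>s image_mset Box \<theta>)"
  unfolding interpolable_within_def seq.sel
proof (intro allI impI)
  fix \<Sigma> \<Lambda> assume partition: "image_mset Box N = \<Sigma> + \<Lambda>"
  obtain A B where N: "N = A + B" and \<Sigma>: "\<Sigma> = image_mset Box A" and \<Lambda>: "\<Lambda> = image_mset Box B"
    using image_mset_eq_plusD[OF partition] by blast
  have "F N = F A + F B" using F unfolding boxable_def N by blast
  then obtain C where C: "interpolant L H (F A) (F B) \<theta> C" "w C \<le> cost (F N \<Rightarrow>\<^sub>s \<theta>)"
    using ex_interpolant interpolable by metis
  have "F (add_mset C B) \<turnstile> \<theta>"
    using C(1) F unfolding interpolant_iff boxable_def by blast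
  moreover from this have "langs L (add_mset C B)"
    using F prvD(1) unfolding boxable_def by blast
  ultimately have "image_mset Box (add_mset C B) \<turnstile> image_mset Box \<theta>" by (intro closed)
  moreover have "image_mset Box A \<turnstile> {#Box C#}"
    using C(1) F unfolding interpolant_iff boxable_def by blast
  ultimately have "interpolant L H \<Sigma> \<Lambda> (image_mset Box \<theta>) (Box C)"
    using C(1) F by (auto simp: interpolant_iff boxable_def \<Sigma> \<Lambda>)
  moreover have "w (Box C) \<le> cost (F N \<Rightarrow>\<^sub>s \<theta>) + 1"
    using C(2) weight_Box[of C] by simp
  ultimately show
    "\<exists>C. interpolant L H \<Sigma> \<Lambda> (image_mset Box \<theta>) C \<and> w C \<le> cost (F N \<Rightarrow>\<^sub>s \<theta>) + 1" by blast
qed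

lemma interpolating_boxing_rule:
  assumes adm: "admissible L H (boxing_rule P \<Gamma> \<Theta>)" and F: "denotes_context P \<Gamma> F" "boxable F"
  shows "interpolating_rule L H w (boxing_rule P \<Gamma> \<Theta>)"
  unfolding interpolating_rule_def
proof (intro allI impI)
  fix Ps S assume "rule_instance L (boxing_rule P \<Gamma> \<Theta>) Ps S" and "\<forall>P\<in>#Ps. interpolable P"
  then obtain \<sigma> N where \<sigma>: "\<forall>n. in_lang L (\<sigma> n)" and Ps: "Ps = {#F N \<Rightarrow>\<^sub>s inst_mset \<sigma> \<Theta>#}"
    and S: "S = (image_mset Box N \<Rightarrow>\<^sub>s image_mset Box (inst_mset \<sigma> \<Theta>))"
    and interpolable: "interpolable (F N \<Rightarrow>\<^sub>s inst_mset \<sigma> \<Theta>)"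
    unfolding rule_instance_def inst_boxing_rule[OF F(1)] by auto
  have "interpolable_within L H w (cost (F N \<Rightarrow>\<^sub>s inst_mset \<sigma> \<Theta>) + 1) S"
    unfolding S
    by (rule interpolable_within_Box[OF F(2) interpolable prv_boxing_rule[OF adm F(1) \<sigma>]])
  then show "interpolable_within L H w ((\<Sum>P\<in>#Ps. cost P + 3) + 2 * size (ante S) + 3) S"
    by (rule interpolable_within_mono) (simp add: Ps)
qed

lemma interpolating_semi_analytic:
  assumes adm: "\<forall>r\<in>R. admissible L H r" and compatible: "modal_compatible R"
    and "r \<in> R" and "semi_analytic r"
  shows "interpolating_rule L H w r"
proof -
  note adm_r = bspec[OF adm \<open>r \<in> R\<close>]
  consider (left) "left_semi_analytic r" | (right) "right_semi_analytic r"
    | (K_D) "rule_K r \<or> rule_D r" | (S4) "rule_RS4 r"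
    using \<open>semi_analytic r\<close> unfolding semi_analytic_def by blast
  then show ?thesis
  proof cases
    case left
    then obtain Ps Gs \<phi> where "block_rule (map (\<lambda>(\<Pi>, prs). Block \<Pi> None prs []) Ps @
        map (\<lambda>(\<Gamma>, \<Delta>, \<phi>ss). Block \<Gamma> (Some \<Delta>) [] \<phi>ss) Gs) {#\<phi>#} {#} r"
      using left_semi_analytic_block_rule by blast
    then show ?thesis by (rule interpolating_rule_block_rule[OF adm_r]) auto
  next
    case right
    then obtain Gs \<phi> where "block_rule (map (\<lambda>(\<Gamma>, prs). Block \<Gamma> None prs []) Gs) {#} {#\<phi>#} r"
      using right_semi_analytic_block_rule by blast
    then show ?thesis by (rule interpolating_rule_block_rule[OF adm_r]) auto
  next
    case K_D
    then obtain k where "k \<in> R" "rule_K k"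
      using compatible \<open>r \<in> R\<close> by (auto simp: modal_compatible_def)
    then have "boxable (\<lambda>N. N)" using adm boxable_K by blast
    then show ?thesis
      using K_D adm_r interpolating_boxing_rule[OF _ denotes_context_items(1)]
      unfolding rule_K_iff rule_D_iff by blast
  next
    case S4
    then obtain l where "l \<in> R" "rule_LS4 l"
      using compatible \<open>r \<in> R\<close> by (auto simp: modal_compatible_def)
    then have "boxable (image_mset Box)" using adm S4 boxable_S4 adm_r by blast
    then show ?thesis
      using S4 adm_r interpolating_boxing_rule[OF _ denotes_context_items(2)]
      unfolding rule_RS4_iff by blast
  qed
qed

lemma interpolating_rule_4_4D:
  assumes adm: "\<forall>r\<in>R. admissible L H r" and compatible: "modal_compatible R"
    and "r \<in> R" and r: "rule_4 r \<or> rule_4D r"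
    and weakening: "admissible L H left_weakening_boxed"
  shows "interpolating_rule L H w r"
proof -
  obtain k where "k \<in> R" "rule_4 k"
    using r compatible \<open>r \<in> R\<close> by (auto simp: modal_compatible_def)
  then have "boxable (\<lambda>N. image_mset Box N + N)" using adm weakening boxable_4 by blast
  then show ?thesis
    using r bspec[OF adm \<open>r \<in> R\<close>] interpolating_boxing_rule[OF _ denotes_context_items(3)]
    unfolding rule_4_iff rule_4D_iff by blast
qed

lemma interpolating_context_sharing:
  assumes "admissible L H r" and "context_sharing_semi_analytic r"
    and "admissible L H left_weakening" and "admissible L H context_sharing_left_imp"
  shows "interpolating_rule L H w r"
proof -
  obtain Gs \<phi> where "block_rule (map (\<lambda>(\<Gamma>, \<Delta>, prs, \<phi>ss). Block \<Gamma> (Some \<Delta>) prs \<phi>ss) Gs) {#\<phi>#} {#} r"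
    using context_sharing_semi_analytic_block_rule[OF assms(2)] by blast
  then show ?thesis
    by (rule interpolating_rule_block_rule[OF assms(1)]) (use assms(3,4) in auto)
qed

lemma interpolating_semi_analytic_4:
  assumes "\<forall>r\<in>R. admissible L H r" and "\<forall>r\<in>R. semi_analytic r \<or> rule_4 r \<or> rule_4D r"
    and "modal_compatible R"
    and "(\<exists>r\<in>R. rule_4 r \<or> rule_4D r) \<longrightarrow> admissible L H left_weakening_boxed"
  shows "\<forall>r\<in>R. interpolating_rule L H w r"
  using assms interpolating_semi_analytic[OF assms(1,3)] interpolating_rule_4_4D[OF assms(1,3)]
  by blast

lemma interpolating_semi_analytic_context_sharing:
  assumes "\<forall>r\<in>R. admissible L H r" and "\<forall>r\<in>R. semi_analytic r \<or> context_sharing_semi_analytic r"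
    and "modal_compatible R"
    and "admissible L H left_weakening" and "admissible L H context_sharing_left_imp"
  shows "\<forall>r\<in>R. interpolating_rule L H w r"
  using assms interpolating_semi_analytic[OF assms(1,3)] interpolating_context_sharing by blast

end

section \<open>Polynomial bounds\<close>

lemma size_ante_le_seq_length: "2 * size (ante S) + 1 \<le> seq_length S"
proof -
  have "2 * size M \<le> (\<Sum>\<phi>\<in>#M. Suc (form_length \<phi>))" for M :: "'c form multiset"
  proof (induction M)
    case (add \<phi> M)
    have "1 \<le> form_length \<phi>" by (cases \<phi>) auto
    then show ?case using add by simp
  qed simp
  from this[of "ante S"] show ?thesis by (simp add: seq_length_def)
qed

lemma proof_length_ge_2: "2 \<le> proof_length \<pi>"
  by (cases \<pi>) (simp add: seq_length_def)

lemma sum_list_power_le: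
  fixes xs :: "nat list"
  shows "(\<Sum>x\<leftarrow>xs. x ^ Suc k) \<le> sum_list xs ^ Suc k"
proof (induction xs)
  case (Cons x xs)
  have "x ^ Suc k + sum_list xs ^ Suc k \<le>
      x * (x + sum_list xs) ^ k + sum_list xs * (x + sum_list xs) ^ k"
    by (auto intro!: add_mono mult_left_mono power_mono)
  also have "\<dots> = (x + sum_list xs) ^ Suc k" by (simp add: algebra_simps)
  finally show ?case using Cons.IH by simp
qed simp

lemma power_absorbs_linear:
  fixes x y :: nat
  assumes "2 \<le> y"
  shows "x ^ (k + 2) + 2 * x + y + 1 \<le> (x + y) ^ (k + 2)"
proof (induction k)
  case 0
  have "x * 2 \<le> x * y" "y * 2 \<le> y * y" using assms by simp_all
  moreover have "(x + y) ^ 2 = x ^ 2 + 2 * (x * y) + y * y"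
    by (simp add: power2_eq_square algebra_simps)
  ultimately show ?case using assms unfolding add_0 by linarith
next
  case (Suc k)
  let ?p = "x ^ (k + 2)" and ?d = "2 * x + y + 1"
  have "1 * ?d \<le> y * (?p + ?d)" using assms by (intro mult_le_mono) simp_all
  then have "x * ?p + ?d \<le> x * (?p + ?d) + y * (?p + ?d)"
    by (intro add_mono mult_le_mono2 le_add1) (simp only: mult_1)
  also have "\<dots> = (x + y) * (?p + ?d)" by (simp add: algebra_simps)
  also have "\<dots> \<le> (x + y) * (x + y) ^ (k + 2)" using Suc.IH by (intro mult_left_mono) simp_all
  finally show ?case by (simp only: add_Suc power_Suc add.assoc)
qed

lemma proof_length_power_step:
  "(\<Sum>t\<leftarrow>ts. proof_length t ^ (k + 2) + 3) + 2 * size (ante S) + 3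
   \<le> proof_length (Node S ts) ^ (k + 2)"
proof -
  let ?x = "\<Sum>t\<leftarrow>ts. proof_length t" and ?y = "Suc (seq_length S)"
  have "(\<Sum>t\<leftarrow>ts. proof_length t ^ (k + 2) + 3) =
      (\<Sum>t\<leftarrow>ts. proof_length t ^ (k + 2)) + 3 * length ts"
    by (induction ts) auto
  moreover have "(\<Sum>t\<leftarrow>ts. proof_length t ^ (k + 2)) \<le> ?x ^ (k + 2)"
    using sum_list_power_le[of "k + 1" "map proof_length ts"] by (simp add: comp_def)
  moreover have "2 * length ts \<le> ?x"
  proof (induction ts)
    case (Cons t ts)
    then show ?case using proof_length_ge_2[of t] by simp
  qed simp
  moreover have "2 * size (ante S) + 1 \<le> seq_length S" by (rule size_ante_le_seq_length)
  moreover have "?x ^ (k + 2) + 2 * ?x + ?y + 1 \<le> (?x + ?y) ^ (k + 2)"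
    by (rule power_absorbs_linear) (simp add: seq_length_def)
  moreover have "proof_length (Node S ts) ^ (k + 2) = (?x + ?y) ^ (k + 2)"
    by (simp add: add.commute)
  ultimately show ?thesis by linarith
qed

section \<open>Transfer of interpolation\<close>

definition has_poly_interpolation ::
  "'c conn set \<Rightarrow> 'c calculus \<Rightarrow> 'c calculus \<Rightarrow> ('c form \<Rightarrow> nat) \<Rightarrow> bool" where
  "has_poly_interpolation L G H w \<longleftrightarrow>
     (\<exists>k. \<forall>\<pi>\<in>proofs L G. interpolable_within L H w (proof_length \<pi> ^ k) (root \<pi>))"

lemma interpolable_within_iff:
  "interpolable_within L H w n S \<longleftrightarrow>
     (\<forall>\<Sigma> \<Lambda> \<Delta>. S = (\<Sigma> + \<Lambda> \<Rightarrow>\<^sub>s \<Delta>) \<longrightarrow> (\<exists>C. interpolant L H \<Sigma> \<Lambda> \<Delta> C \<and> w C \<le> n))"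
  by (cases S) (simp add: interpolable_within_def)

lemma has_interpolation_iff:
  "has_interpolation L G H \<longleftrightarrow> has_poly_interpolation L G H (\<lambda>_. 0)"
  by (simp add: has_interpolation_def has_poly_interpolation_def interpolable_within_iff)

lemma has_feasible_interpolation_iff:
  "has_feasible_interpolation L G H \<longleftrightarrow> has_poly_interpolation L G H form_length"
  by (simp add: has_feasible_interpolation_def has_poly_interpolation_def interpolable_within_iff)

lemma interpolable_within_step:
  assumes r: "interpolating_rule L H w r" "rule_instance L r (mset (map root ts)) S"
    and prems: "\<forall>t\<in>set ts. interpolable_within L H w (b t) (root t)"
  shows "interpolable_within L H w ((\<Sum>t\<leftarrow>ts. b t + 3) + 2 * size (ante S) + 3) S"
proof -
  have "interpolable_within L H w
      ((\<Sum>P\<in>#mset (map root ts). interpolation_cost L H w P + 3) + 2 * size (ante S) + 3) S"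
    using r prems unfolding interpolating_rule_def by fastforce
  moreover have "(\<Sum>P\<in>#mset (map root ts). interpolation_cost L H w P + 3) =
      (\<Sum>t\<leftarrow>ts. interpolation_cost L H w (root t) + 3)"
    by (induction ts) auto
  moreover have "(\<Sum>t\<leftarrow>ts. interpolation_cost L H w (root t) + 3) \<le> (\<Sum>t\<leftarrow>ts. b t + 3)"
    using prems interpolation_cost_le by (intro sum_list_mono add_right_mono) blast
  ultimately show ?thesis by (auto elim: interpolable_within_mono)
qed

lemma has_poly_interpolation_AxExt:
  assumes rules: "\<forall>r\<in>R. interpolating_rule L (AxExt G R) w r"
    and G: "has_poly_interpolation L G (AxExt G R) w"
  shows "has_poly_interpolation L (AxExt G R) (AxExt G R) w"
proof -
  let ?H = "AxExt G R"
  obtain k where k: "\<forall>\<pi>\<in>proofs L G. interpolable_within L ?H w (proof_length \<pi> ^ k) (root \<pi>)"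
    using G by (auto simp: has_poly_interpolation_def)
  have "interpolable_within L ?H w (proof_length \<pi> ^ (k + 2)) (root \<pi>)" if "\<pi> \<in> proofs L ?H" for \<pi>
  proof -
    have "\<pi> \<in> derivs L (proofs L G) R" using that by simp
    then show ?thesis
    proof induction
      case (base \<pi>)
      have "proof_length \<pi> ^ k \<le> proof_length \<pi> ^ (k + 2)"
        using proof_length_ge_2[of \<pi>] by (intro power_increasing) auto
      then show ?case using k base interpolable_within_mono by blast
    next
      case (step r ts S)
      then have "interpolable_within L ?H w
          ((\<Sum>t\<leftarrow>ts. proof_length t ^ (k + 2) + 3) + 2 * size (ante S) + 3) S"
        using rules by (intro interpolable_within_step[of L ?H w r]) auto
      then show ?case
        unfolding ptree.sel by (rule interpolable_within_mono) (rule proof_length_power_step)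
    qed
  qed
  then show ?thesis unfolding has_poly_interpolation_def by blast
qed

lemma admissible_AxExt: "r \<in> R \<Longrightarrow> admissible L (AxExt G R) r"
  by (auto simp: admissible_def provable_AxExt intro: derivable.rule)

lemma interpolation_transfer:
  fixes L :: "'c conn set"
  assumes "calculus_in_lang L H" and "extends_FLe L H" and H: "H = AxExt G R"
    and rules: "\<And>w. FLe_interpolation L H w \<Longrightarrow> \<forall>r\<in>R. admissible L H r \<Longrightarrow>
      \<forall>r\<in>R. interpolating_rule L H w r"
  shows "(has_interpolation L G H \<longrightarrow> has_interpolation L H H) \<and>
    (has_feasible_interpolation L G H \<longrightarrow> has_feasible_interpolation L H H)"
proof -
  have "FLe_extension L H" using assms(1,2) by unfold_locales
  then have "\<forall>r\<in>R. interpolating_rule L H w r" if "formula_weight w" for w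
    using rules that admissible_AxExt unfolding H by (blast intro: FLe_interpolation.intro)
  then have "has_poly_interpolation L G H w \<Longrightarrow> has_poly_interpolation L H H w"
    if "formula_weight w" for w
    using that unfolding H by (blast intro: has_poly_interpolation_AxExt)
  from this[OF formula_weight_zero] this[OF formula_weight_form_length] show ?thesis
    unfolding has_interpolation_iff has_feasible_interpolation_iff by blast
qed

theorem theorem4p4:
  fixes L :: "'c conn set" and G H :: "'c calculus"
  assumes "calculus_in_lang L G" and "calculus_in_lang L H" and "extends_FLe L H"
  shows
    "(\<forall>R. H = AxExt G R \<longrightarrow>
        (\<forall>r\<in>R. semi_analytic r \<or> rule_4 r \<or> rule_4D r) \<longrightarrow>
        modal_compatible R \<longrightarrow>
        ((\<exists>r\<in>R. rule_4 r \<or> rule_4D r) \<longrightarrow> admissible L H left_weakening_boxed) \<longrightarrow>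
        (has_interpolation L G H \<longrightarrow> has_interpolation L H H) \<and>
        (has_feasible_interpolation L G H \<longrightarrow> has_feasible_interpolation L H H)) \<and>
     (\<forall>R. H = AxExt G R \<longrightarrow>
        (\<forall>r\<in>R. semi_analytic r \<or> context_sharing_semi_analytic r) \<longrightarrow>
        modal_compatible R \<longrightarrow>
        admissible L H left_weakening \<longrightarrow>
        admissible L H right_weakening \<longrightarrow>
        admissible L H context_sharing_left_imp \<longrightarrow>
        (has_interpolation L G H \<longrightarrow> has_interpolation L H H) \<and>
        (has_feasible_interpolation L G H \<longrightarrow> has_feasible_interpolation L H H))"
proof (rule conjI; intro allI impI)
  fix R
  assume H: "H = AxExt G R" and R: "\<forall>r\<in>R. semi_analytic r \<or> rule_4 r \<or> rule_4D r"
    "modal_compatible R" "(\<exists>r\<in>R. rule_4 r \<or> rule_4D r) \<longrightarrow> admissible L H left_weakening_boxed"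
  show "(has_interpolation L G H \<longrightarrow> has_interpolation L H H) \<and>
    (has_feasible_interpolation L G H \<longrightarrow> has_feasible_interpolation L H H)"
    using FLe_interpolation.interpolating_semi_analytic_4[OF _ _ R]
    by (rule interpolation_transfer[OF assms(2,3) H])
next
  fix R
  assume H: "H = AxExt G R" and R: "\<forall>r\<in>R. semi_analytic r \<or> context_sharing_semi_analytic r"
    "modal_compatible R" "admissible L H left_weakening" "admissible L H context_sharing_left_imp"
  show "(has_interpolation L G H \<longrightarrow> has_interpolation L H H) \<and>
    (has_feasible_interpolation L G H \<longrightarrow> has_feasible_interpolation L H H)"
    using FLe_interpolation.interpolating_semi_analytic_context_sharing[OF _ _ R]
    by (rule interpolation_transfer[OF assms(2,3) H])
qed

end
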